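(* Let $(X_t)_{t\ge 0}$ be a continuous-time Markov process on a measurable space $(\mathbb X,\mathcal E)$, with generator $L$, semigroup $(P_t)_{t\ge 0}$, invariant law $\pi$ and algebra $\mathcal A$, satisfying the standing assumptions listed in the context, and let $\gamma_\star$ be its local Poincaré constant. Then for every $0<\varepsilon\le 1/2$, $$\mathrm{w}_{\mathrm{mix}}(\varepsilon)\;\le\;\frac{3}{2\gamma_\star}\log\frac1\varepsilon .$$ In particular, consider a sequence, indexed by $n\in\mathbb N$, of such Markov processes (the state space, the initial condition, the dynamics, and hence $\gamma_\star$ and $\mathrm{t}_{\mathrm{mix}}$, all being allowed to depend on $n$). If for some (hence every) $\varepsilon\in(0,1)$ $$\gamma_\star\times \mathrm{t}_{\mathrm{mix}}(\varepsilon)\xrightarrow[n\to\infty]{}\infty,$$ then the sequence exhibits cutoff, i.e. $$\forall \varepsilon\in(0,1),\qquad \frac{\mathrm{t}_{\mathrm{mix}}(1-\varepsilon)}{\mathrm{t}_{\mathrm{mix}}(\varepsilon)}\xrightarrow[n\to\infty]{}1 .$$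
   Context: Standing setting. $(X_t)_{t\ge0}$ is a continuous-time Markov process with values in a measurable space $(\mathbb X,\mathcal E)$, with generator $L$ (with domain in $L^2(\pi)$), semigroup $(P_t)_{t\ge0}$ and invariant law $\pi\in\mathcal P(\mathbb X)$, where $\mathcal P(\mathbb X)$ is the set of probability measures on $(\mathbb X,\mathcal E)$. No reversibility is assumed and the law of $X_0$ is arbitrary. Write $\mu_t:=\mathrm{law}(X_t)=\mu_0P_t$. It is assumed that $\mu_t\ll\pi$ for every $t>0$, and that $\mathrm d_{\mathrm{TV}}(\mu_t,\pi)\to0$ as $t\to\infty$, where $\mathrm d_{\mathrm{TV}}(\mu,\nu):=\sup_{A\in\mathcal E}|\mu(A)-\nu(A)|$. One is also given an algebra $\mathcal A\subset L^\infty(\pi)$ of real functions that contains the constants, is contained in the domain of $L$, is stable under $(P_t)_{t\ge0}$, and is dense in $L^2(\pi)$. The carré du champ operator $\Gamma:\mathcal A\to L^2(\pi)$ is $\Gamma f:=\tfrac12 L(f^2)-fLf$. Poincaré constants. For a probability measure $\mu\ll\pi$, $\gamma(\mu)\in[0,\infty]$ is the largest constant such that $\gamma(\mu)\,\mathrm{Var}_\mu(f)\le\int\Gamma f\,\mathrm d\mu$ for all $f\in\mathcal A$ (i.e. the supremum of all finite constants with this property). The local Poincaré constant of the process is $\gamma_\star:=\inf_{t>0}\gamma(\mu_t)$. Conventions: $1/0=+\infty$, $1/\infty=0$. Mixing times. For $\varepsilon\in(0,1)$, $\mathrm t_{\mathrm{mix}}(\varepsilon):=\inf\{t\ge0:\mathrm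 d_{\mathrm{TV}}(\mu_t,\pi)\le\varepsilon\}$, and for $0<\varepsilon\le1/2$, $\mathrm w_{\mathrm{mix}}(\varepsilon):=\mathrm t_{\mathrm{mix}}(\varepsilon)-\mathrm t_{\mathrm{mix}}(1-\varepsilon)$. *)

theory Defs
  imports "HOL-Probability.Probability"
begin

text \<open>
  Throughout, the measurable state space is carried by the invariant law \<open>\<pi>\<close>: it is
  \<open>(space \<pi>, sets \<pi>)\<close>. Time is \<open>real\<close>, only used for \<open>t \<ge> 0\<close>. Elements of \<open>L\<^sup>2(\<pi>)\<close> and of the
  space of essentially bounded functions are represented by measurable functions; all notions
  below are invariant under modification on \<open>\<pi>\<close>-null sets.
\<close>

definition L2_space :: "'a measure \<Rightarrow> ('a \<Rightarrow> real) set" where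
  "L2_space \<pi> = {f \<in> borel_measurable \<pi>. integrable \<pi> (\<lambda>x. (f x)\<^sup>2)}"

definition Linf_space :: "'a measure \<Rightarrow> ('a \<Rightarrow> real) set" where
  "Linf_space \<pi> = {f \<in> borel_measurable \<pi>. \<exists>C. AE x in \<pi>. \<bar>f x\<bar> \<le> C}"

text \<open>The operator \<open>P\<^sub>t\<close> on functions associated with the family of kernels \<open>P\<close>.\<close>

definition semigroup_op :: "(real \<Rightarrow> 'a \<Rightarrow> 'a measure) \<Rightarrow> real \<Rightarrow> ('a \<Rightarrow> real) \<Rightarrow> 'a \<Rightarrow> real" where
  "semigroup_op P t f x = (\<integral>y. f y \<partial>P t x)"

definition has_generator ::
    "'a measure \<Rightarrow> (real \<Rightarrow> 'a \<Rightarrow> 'a measure) \<Rightarrow> ('a \<Rightarrow> real) \<Rightarrow> ('a \<Rightarrow> real) \<Rightarrow> bool" where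
  "has_generator \<pi> P f g \<longleftrightarrow> f \<in> L2_space \<pi> \<and> g \<in> L2_space \<pi> \<and>
     ((\<lambda>t. \<integral>x. ((semigroup_op P t f x - f x) / t - g x)\<^sup>2 \<partial>\<pi>) \<longlongrightarrow> 0) (at_right 0)"

definition generator_domain :: "'a measure \<Rightarrow> (real \<Rightarrow> 'a \<Rightarrow> 'a measure) \<Rightarrow> ('a \<Rightarrow> real) set" where
  "generator_domain \<pi> P = {f. \<exists>g. has_generator \<pi> P f g}"

text \<open>\<open>L f\<close>; on the domain it is determined up to \<open>\<pi>\<close>-null sets.\<close>

definition generator ::
    "'a measure \<Rightarrow> (real \<Rightarrow> 'a \<Rightarrow> 'a measure) \<Rightarrow> ('a \<Rightarrow> real) \<Rightarrow> 'a \<Rightarrow> real" where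
  "generator \<pi> P f = (SOME g. has_generator \<pi> P f g)"

definition carre_du_champ ::
    "'a measure \<Rightarrow> (real \<Rightarrow> 'a \<Rightarrow> 'a measure) \<Rightarrow> ('a \<Rightarrow> real) \<Rightarrow> 'a \<Rightarrow> real" where
  "carre_du_champ \<pi> P f x =
     1 / 2 * generator \<pi> P (\<lambda>y. (f y)\<^sup>2) x - f x * generator \<pi> P f x"

text \<open>
  For \<open>\<mu> \<lless> \<pi>\<close> the function \<open>\<Gamma> f\<close> need not be \<open>\<mu>\<close>-integrable, but it is nonnegative almost
  everywhere, so its integral is taken as an element of \<open>[0, \<infinity>]\<close>.
\<close>

definition poincare_const ::
    "'a measure \<Rightarrow> (real \<Rightarrow> 'a \<Rightarrow> 'a measure) \<Rightarrow> ('a \<Rightarrow> real) set \<Rightarrow> 'a measure \<Rightarrow> ennreal" where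
  "poincare_const \<pi> P \<A> \<mu> =
     Sup {ennreal c | c. 0 \<le> c \<and>
       (\<forall>f\<in>\<A>. ennreal (c * prob_space.variance \<mu> f) \<le> (\<integral>\<^sup>+x. ennreal (carre_du_champ \<pi> P f x) \<partial>\<mu>))}"

definition local_poincare_const ::
    "'w measure \<Rightarrow> (real \<Rightarrow> 'w \<Rightarrow> 'a) \<Rightarrow> 'a measure \<Rightarrow> (real \<Rightarrow> 'a \<Rightarrow> 'a measure) \<Rightarrow>
     ('a \<Rightarrow> real) set \<Rightarrow> ennreal" where
  "local_poincare_const \<Omega> X \<pi> P \<A> = (INF t\<in>{0<..}. poincare_const \<pi> P \<A> (distr \<Omega> \<pi> (X t)))"

definition d_TV :: "'a measure \<Rightarrow> 'a measure \<Rightarrow> real" where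
  "d_TV \<mu> \<nu> = (SUP A\<in>sets \<mu>. \<bar>measure \<mu> A - measure \<nu> A\<bar>)"

definition t_mix :: "'w measure \<Rightarrow> (real \<Rightarrow> 'w \<Rightarrow> 'a) \<Rightarrow> 'a measure \<Rightarrow> real \<Rightarrow> real" where
  "t_mix \<Omega> X \<pi> \<epsilon> = Inf {t. 0 \<le> t \<and> d_TV (distr \<Omega> \<pi> (X t)) \<pi> \<le> \<epsilon>}"

definition w_mix :: "'w measure \<Rightarrow> (real \<Rightarrow> 'w \<Rightarrow> 'a) \<Rightarrow> 'a measure \<Rightarrow> real \<Rightarrow> real" where
  "w_mix \<Omega> X \<pi> \<epsilon> = t_mix \<Omega> X \<pi> \<epsilon> - t_mix \<Omega> X \<pi> (1 - \<epsilon>)"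

definition natural_filtration ::
    "'w measure \<Rightarrow> (real \<Rightarrow> 'w \<Rightarrow> 'a) \<Rightarrow> 'a measure \<Rightarrow> real \<Rightarrow> 'w measure" where
  "natural_filtration \<Omega> X \<pi> s =
     sigma (space \<Omega>) (\<Union>u\<in>{0..s}. sets (vimage_algebra (space \<Omega>) (X u) \<pi>))"

locale markov_process =
  \<Omega>: prob_space \<Omega> + \<pi>: prob_space \<pi>
  for \<Omega> :: "'w measure" and X :: "real \<Rightarrow> 'w \<Rightarrow> 'a" and \<pi> :: "'a measure"
    and P :: "real \<Rightarrow> 'a \<Rightarrow> 'a measure" +
  assumes X_measurable: "\<And>t. 0 \<le> t \<Longrightarrow> X t \<in> \<Omega> \<rightarrow>\<^sub>M \<pi>"
    and kernel: "\<And>t. 0 \<le> t \<Longrightarrow> P t \<in> \<pi> \<rightarrow>\<^sub>M prob_algebra \<pi>"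
    and kernel_0: "\<And>x. x \<in> space \<pi> \<Longrightarrow> P 0 x = return \<pi> x"
    and chapman_kolmogorov:
      "\<And>s t x. 0 \<le> s \<Longrightarrow> 0 \<le> t \<Longrightarrow> x \<in> space \<pi> \<Longrightarrow> P (s + t) x = P s x \<bind> P t"
    and markov_property:
      "\<And>s t B. 0 \<le> s \<Longrightarrow> 0 \<le> t \<Longrightarrow> B \<in> sets \<pi> \<Longrightarrow>
        AE \<omega> in \<Omega>. real_cond_exp \<Omega> (natural_filtration \<Omega> X \<pi> s)
          (indicator (X (s + t) -` B \<inter> space \<Omega>)) \<omega> = measure (P t (X s \<omega>)) B"
    and invariant: "\<And>t. 0 \<le> t \<Longrightarrow> \<pi> \<bind> P t = \<pi>"

text \<open>
  The algebra \<open>\<A>\<close> of equivalence classes is represented by the set of all measurable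
  representatives of its elements, whence the saturation condition \<open>algebra_AE\<close>.
\<close>

locale markov_mixing_process = markov_process \<Omega> X \<pi> P
  for \<Omega> :: "'w measure" and X :: "real \<Rightarrow> 'w \<Rightarrow> 'a" and \<pi> :: "'a measure"
    and P :: "real \<Rightarrow> 'a \<Rightarrow> 'a measure" +
  fixes \<A> :: "('a \<Rightarrow> real) set"
  assumes law_ac: "\<And>t. 0 < t \<Longrightarrow> absolutely_continuous \<pi> (distr \<Omega> \<pi> (X t))"
    and law_tendsto: "((\<lambda>t. d_TV (distr \<Omega> \<pi> (X t)) \<pi>) \<longlongrightarrow> 0) at_top"
    and algebra_Linf: "\<A> \<subseteq> Linf_space \<pi>"
    and algebra_AE:
      "\<And>f g. f \<in> \<A> \<Longrightarrow> g \<in> borel_measurable \<pi> \<Longrightarrow> (AE x in \<pi>. f x = g x) \<Longrightarrow> g \<in> \<A>"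
    and algebra_const: "\<And>c. (\<lambda>_. c) \<in> \<A>"
    and algebra_add: "\<And>f g. f \<in> \<A> \<Longrightarrow> g \<in> \<A> \<Longrightarrow> (\<lambda>x. f x + g x) \<in> \<A>"
    and algebra_mult: "\<And>f g. f \<in> \<A> \<Longrightarrow> g \<in> \<A> \<Longrightarrow> (\<lambda>x. f x * g x) \<in> \<A>"
    and algebra_domain: "\<A> \<subseteq> generator_domain \<pi> P"
    and algebra_stable: "\<And>t f. 0 \<le> t \<Longrightarrow> f \<in> \<A> \<Longrightarrow> semigroup_op P t f \<in> \<A>"
    and algebra_dense:
      "\<And>f e. f \<in> L2_space \<pi> \<Longrightarrow> 0 < e \<Longrightarrow> \<exists>g\<in>\<A>. (\<integral>x. (f x - g x)\<^sup>2 \<partial>\<pi>) < e"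
begin

text \<open>
  The infimum defining \<open>t_mix\<close> is over a nonempty set bounded below, and the window \<open>w_mix\<close> is
  nonnegative, so that nothing is lost by comparing it in \<open>ennreal\<close>.
\<close>

lemma t_mix_set_nonempty:
  assumes "0 < \<epsilon>"
  shows "{t. 0 \<le> t \<and> d_TV (distr \<Omega> \<pi> (X t)) \<pi> \<le> \<epsilon>} \<noteq> {}"
proof -
  have "\<forall>\<^sub>F t in at_top. d_TV (distr \<Omega> \<pi> (X t)) \<pi> < \<epsilon>"
    using order_tendstoD(2)[OF law_tendsto assms] .
  then have "\<forall>\<^sub>F t in at_top. 0 \<le> t \<and> d_TV (distr \<Omega> \<pi> (X t)) \<pi> \<le> \<epsilon>"
    using eventually_ge_at_top[of 0] by eventually_elim auto
  then show ?thesis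
    by (auto simp: eventually_at_top_linorder)
qed

lemma w_mix_nonneg:
  assumes "0 < \<epsilon>" "\<epsilon> \<le> 1 / 2"
  shows "0 \<le> w_mix \<Omega> X \<pi> \<epsilon>"
proof -
  have "t_mix \<Omega> X \<pi> (1 - \<epsilon>) \<le> t_mix \<Omega> X \<pi> \<epsilon>"
    unfolding t_mix_def
  proof (rule cInf_superset_mono[OF t_mix_set_nonempty[OF assms(1)]])
    show "bdd_below {t. 0 \<le> t \<and> d_TV (distr \<Omega> \<pi> (X t)) \<pi> \<le> 1 - \<epsilon>}"
      by (auto intro: bdd_belowI[of _ 0])
    show "{t. 0 \<le> t \<and> d_TV (distr \<Omega> \<pi> (X t)) \<pi> \<le> \<epsilon>}
        \<subseteq> {t. 0 \<le> t \<and> d_TV (distr \<Omega> \<pi> (X t)) \<pi> \<le> 1 - \<epsilon>}"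
      using assms(2) by auto
  qed
  then show ?thesis
    by (simp add: w_mix_def)
qed

end

end

theory Submission
  imports Defs
begin

text \<open>
  For \<open>f \<in> \<A>\<close> the function \<open>s \<mapsto> Var[\<mu>\<^sub>s](P\<^bsub>t-s\<^esub> f)\<close> has derivative \<open>2 \<integral> \<Gamma>(P\<^bsub>t-s\<^esub> f) d\<mu>\<^sub>s\<close>, because
  the mean of \<open>P\<^bsub>t-s\<^esub> f\<close> under \<open>\<mu>\<^sub>s\<close> does not depend on \<open>s\<close>. The local Poincare inequality
  therefore gives \<open>Var[\<mu>\<^sub>s](P\<^sub>r f) \<le> e\<^bsup>-2\<gamma>r\<^esup> Var[\<mu>\<^bsub>s+r\<^esub>](f)\<close>, also for \<open>f = 1\<^sub>B\<close> by density.
  If \<open>d_TV \<mu>\<^sub>s \<pi> \<le> 1 - \<epsilon>\<close>, then \<open>\<mu>\<^sub>s\<close> and \<open>\<mu>\<^sub>u\<close> have a common part of mass almost \<open>\<epsilon>\<close> for large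
  \<open>u\<close>; on it \<open>P\<^sub>r 1\<^sub>B\<close> is close both to \<open>\<mu>\<^bsub>s+r\<^esub>(B)\<close> and to \<open>\<mu>\<^bsub>u+r\<^esub>(B) \<rightarrow> \<pi>(B)\<close>. This yields
  \<open>\<epsilon> (\<mu>\<^bsub>s+r\<^esub>(B) - \<pi>(B))\<^sup>2 \<le> e\<^bsup>-2\<gamma>r\<^esup>\<close>, and \<open>r = 3/(2\<gamma>) ln (1/\<epsilon>)\<close> makes the right side \<open>\<epsilon>\<^sup>3\<close>.
\<close>

section \<open>Bounded functions and the Markov semigroup\<close>

text \<open>The gap between \<open>\<pi>\<close> and the laws shapes the proof. The generator is a
  limit in \<open>L2(\<pi>)\<close>, while the density of a law is merely integrable, so the
  derivative is replaced by a lower bound on backward difference quotients; a monotone function with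
  such bounds still grows exponentially. The initial law and the kernels \<open>P t x\<close> may
  even charge \<open>\<pi>\<close>-null sets. Hence bounds are asked at every point, differentiation
  is confined to positive times, and time 0 is reached by monotonicity. The constant
  \<open>\<gamma>\<close> controls the laws at positive times, not \<open>\<pi>\<close>; this is why
  a law is compared with a later law and \<open>\<pi>\<close> enters only in the limit. Constants:
  the variance of an indicator is at most 1/4 under either law, and splitting a squared difference
  of means costs a factor 2, so the prefactor is 2 (1/4 + 1/4) = 1. In the exponent 3, one factor
  \<open>\<epsilon>\<close> pays for the mass of the common part and two for the square of the
  target \<open>\<epsilon>\<close>. Since \<open>\<gamma>\<close> may be infinite or not attained,
  all estimates are proved for real \<open>c\<close> strictly below it.\<close>

definition bdd_measurable :: "'a measure \<Rightarrow> real \<Rightarrow> ('a \<Rightarrow> real) set" where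
  "bdd_measurable M C = {f \<in> borel_measurable M. \<forall>x\<in>space M. \<bar>f x\<bar> \<le> C}"

lemma bdd_measurable_measurable: "f \<in> bdd_measurable M C \<Longrightarrow> f \<in> borel_measurable M"
  and bdd_measurable_bound: "f \<in> bdd_measurable M C \<Longrightarrow> x \<in> space M \<Longrightarrow> \<bar>f x\<bar> \<le> C"
  by (auto simp: bdd_measurable_def)

lemma bdd_measurable_power2:
  assumes "f \<in> bdd_measurable M C" shows "(\<lambda>x. (f x)\<^sup>2) \<in> bdd_measurable M (C\<^sup>2)"
proof -
  have "(f x)\<^sup>2 \<le> C\<^sup>2" if "x \<in> space M" for x
    using bdd_measurable_bound[OF assms that] by (metis abs_ge_zero abs_le_square_iff abs_of_nonneg order_trans)
  then show ?thesis
    using assms by (auto simp: bdd_measurable_def)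
qed

lemma bdd_measurable_cong_sets:
  "sets M = sets N \<Longrightarrow> bdd_measurable M C = bdd_measurable N C"
  unfolding bdd_measurable_def using measurable_cong_sets[of M N borel borel]
  by (auto dest: sets_eq_imp_space_eq)

lemma integrable_bdd_measurable:
  assumes "prob_space N" "sets N = sets M" "f \<in> bdd_measurable M C"
  shows "integrable N f"
proof -
  interpret prob_space N by fact
  show ?thesis
    using assms(3) unfolding bdd_measurable_cong_sets[OF assms(2), symmetric]
    by (intro integrable_const_bound[where B=C])
       (auto intro: bdd_measurable_measurable simp: bdd_measurable_bound)
qed

lemma integral_bdd_measurable_le:
  assumes "prob_space N" "sets N = sets M" "f \<in> bdd_measurable M C"
  shows "\<bar>\<integral>x. f x \<partial>N\<bar> \<le> C"
proof -
  interpret prob_space N by fact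
  have i: "integrable N f" using integrable_bdd_measurable[OF assms] .
  have sp: "space N = space M" using assms(2) by (rule sets_eq_imp_space_eq)
  have "\<bar>f x\<bar> \<le> C" if "x \<in> space N" for x
    using bdd_measurable_bound[OF assms(3)] that by (simp add: sp)
  then have b: "f x \<le> C" "- C \<le> f x" if "x \<in> space N" for x
    using that by (auto simp: abs_le_iff minus_le_iff)
  have "(\<integral>x. f x \<partial>N) \<le> (\<integral>x. C \<partial>N)" "(\<integral>x. - C \<partial>N) \<le> (\<integral>x. f x \<partial>N)"
    by (intro integral_mono i integrable_const b; assumption)+
  then show ?thesis by (simp add: prob_space)
qed

lemma integral_bind_bdd_measurable:
  assumes "prob_space N" "sets N = sets M" "K \<in> M \<rightarrow>\<^sub>M prob_algebra L" "f \<in> bdd_measurable L C"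
  shows "(\<integral>y. f y \<partial>(N \<bind> K)) = (\<integral>x. (\<integral>y. f y \<partial>K x) \<partial>N)"
proof -
  interpret prob_space N by fact
  have K: "K \<in> N \<rightarrow>\<^sub>M subprob_algebra L"
    using measurable_prob_algebraD[OF assms(3)] measurable_cong_sets[OF assms(2) refl] by blast
  have f: "f \<in> borel_measurable L" using assms(4) by (rule bdd_measurable_measurable)
  show ?thesis
    unfolding bind_nonempty''[OF K not_empty]
  proof (subst integral_join[where N=L and B=C and B'=1])
    show "(\<integral>M'. integral\<^sup>L M' f \<partial>distr N (subprob_algebra L) K) = (\<integral>x. (\<integral>y. f y \<partial>K x) \<partial>N)"
      using K f by (intro integral_distr) auto
  next
    show "finite_measure (distr N (subprob_algebra L) K)"
      using K by (intro finite_measure_distr)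
    show "AE M' in distr N (subprob_algebra L) K. emeasure M' (space M') \<le> ennreal 1"
      by (intro AE_I2) (auto simp: space_subprob_algebra subprob_space.emeasure_space_le_1)
  qed (use f assms(4) in \<open>auto dest: bdd_measurable_bound\<close>)
qed

context markov_process
begin

abbreviation law :: "real \<Rightarrow> 'a measure" where
  "law t \<equiv> distr \<Omega> \<pi> (X t)"

lemma prob_space_law: "0 \<le> t \<Longrightarrow> prob_space (law t)"
  using X_measurable by (rule \<Omega>.prob_space_distr)

lemma kernel_prob_space:
  assumes "0 \<le> t" "x \<in> space \<pi>" shows "prob_space (P t x)" "sets (P t x) = sets \<pi>"
  using measurable_space[OF kernel[OF assms(1)] assms(2)] by (auto simp: space_prob_algebra)

lemma semigroup_op_bdd_measurable:
  assumes "0 \<le> t" "f \<in> bdd_measurable \<pi> C"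
  shows "semigroup_op P t f \<in> bdd_measurable \<pi> C"
  unfolding bdd_measurable_def
proof safe
  have "f \<in> borel_measurable \<pi>" using assms(2) by (rule bdd_measurable_measurable)
  from measurable_compose[OF measurable_prob_algebraD[OF kernel[OF assms(1)]] integral_measurable_subprob_algebra[OF this]]
  show "semigroup_op P t f \<in> borel_measurable \<pi>"
    unfolding semigroup_op_def .
  show "\<bar>semigroup_op P t f x\<bar> \<le> C" if "x \<in> space \<pi>" for x
    unfolding semigroup_op_def
    using integral_bdd_measurable_le[OF kernel_prob_space[OF assms(1) that] assms(2)] .
qed

lemma integral_bind_kernel:
  assumes "0 \<le> t" "f \<in> bdd_measurable \<pi> C" "prob_space N" "sets N = sets \<pi>"
  shows "(\<integral>y. f y \<partial>(N \<bind> P t)) = (\<integral>x. semigroup_op P t f x \<partial>N)"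
  unfolding semigroup_op_def
  using integral_bind_bdd_measurable[OF assms(3,4) kernel[OF assms(1)] assms(2)] .

lemma semigroup_op_add:
  assumes "0 \<le> s" "0 \<le> t" "f \<in> bdd_measurable \<pi> C" "x \<in> space \<pi>"
  shows "semigroup_op P (s + t) f x = semigroup_op P s (semigroup_op P t f) x"
  using integral_bind_kernel[OF assms(2,3) kernel_prob_space[OF assms(1,4)]]
    chapman_kolmogorov[OF assms(1,2,4)]
  by (simp add: semigroup_op_def)

text \<open>Taking expectations in \<open>markov_property\<close> removes the conditioning and
  leaves the integral of \<open>measure (P t x) B\<close> over the law of \<open>X s\<close>. From
  here on the process enters only through its laws.\<close>

lemma law_add:
  assumes "0 \<le> s" "0 \<le> t"
  shows "law (s + t) = law s \<bind> P t"
proof -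
  have l: "law s \<in> space (prob_algebra \<pi>)"
    using prob_space_law[OF assms(1)] by (simp add: space_prob_algebra)
  interpret l: prob_space "law s" using prob_space_law[OF assms(1)] .
  interpret l2: prob_space "law (s + t)" using prob_space_law[of "s + t"] assms by simp
  interpret b: prob_space "law s \<bind> P t"
    using prob_space_bind'[OF l kernel[OF assms(2)]] .
  note [measurable] = X_measurable[OF assms(1)]
  have Xst [measurable]: "X (s + t) \<in> \<Omega> \<rightarrow>\<^sub>M \<pi>" using X_measurable assms by simp
  have subalg: "subalgebra \<Omega> (natural_filtration \<Omega> X \<pi> s)"
    unfolding subalgebra_def natural_filtration_def
  proof safe
    have sub: "(\<Union>u\<in>{0..s}. sets (vimage_algebra (space \<Omega>) (X u) \<pi>)) \<subseteq> sets \<Omega>"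
      using X_measurable by (fastforce simp: measurable_iff_sets)
    then have *: "(\<Union>u\<in>{0..s}. sets (vimage_algebra (space \<Omega>) (X u) \<pi>)) \<subseteq> Pow (space \<Omega>)"
      using sets.space_closed by blast
    fix A assume "A \<in> sets (sigma (space \<Omega>) (\<Union>u\<in>{0..s}. sets (vimage_algebra (space \<Omega>) (X u) \<pi>)))"
    then show "A \<in> sets \<Omega>"
      using sub unfolding sets_measure_of[OF *] by (meson sets.sigma_sets_subset subsetD)
  qed (auto simp: space_measure_of_conv)
  interpret F: sigma_finite_subalgebra \<Omega> "natural_filtration \<Omega> X \<pi> s"
    by (intro finite_measure_subalgebra_is_sigma_finite finite_measure_subalgebra.intro
        \<Omega>.finite_measure_axioms finite_measure_subalgebra_axioms.intro subalg)
  show ?thesis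
  proof (rule measure_eqI)
    show S: "sets (law (s + t)) = sets (law s \<bind> P t)"
      using sets_bind'[OF l kernel[OF assms(2)]] by simp
    fix B assume "B \<in> sets (law (s + t))"
    then have B [measurable]: "B \<in> sets \<pi>" by simp
    have B2: "B \<in> sets (law s \<bind> P t)" using S B by auto
    let ?B = "X (s + t) -` B \<inter> space \<Omega>"
    have BO: "?B \<in> sets \<Omega>" by measurable
    have ib: "indicator B \<in> bdd_measurable \<pi> 1"
      by (auto simp: bdd_measurable_def indicator_def)
    have "measure (law (s + t)) B = measure \<Omega> ?B"
      by (simp add: measure_distr)
    also have "\<dots> = (\<integral>\<omega>. indicator ?B \<omega> \<partial>\<Omega>)" using BO by simp
    also have "\<dots> = (\<integral>\<omega>. real_cond_exp \<Omega> (natural_filtration \<Omega> X \<pi> s) (indicator ?B) \<omega> \<partial>\<Omega>)"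
      using BO by (intro F.real_cond_exp_int(2)[symmetric]) (auto simp: less_top[symmetric])
    also have "\<dots> = (\<integral>\<omega>. measure (P t (X s \<omega>)) B \<partial>\<Omega>)"
      using kernel[OF assms(2)]
      by (intro integral_cong_AE markov_property assms B
          measurable_compose[OF X_measurable[OF assms(1)]] measurable_compose[OF kernel[OF assms(2)]]
          measurable_measure_prob_algebra borel_measurable_cond_exp2)
    also have "\<dots> = (\<integral>x. measure (P t x) B \<partial>law s)"
      by (subst integral_distr) (auto intro!: X_measurable assms measurable_compose[OF kernel[OF assms(2)]])
    also have "\<dots> = (\<integral>x. semigroup_op P t (indicator B) x \<partial>law s)"
      by (intro Bochner_Integration.integral_cong)
         (auto simp: semigroup_op_def kernel_prob_space(2)[OF assms(2)] )
    also have "\<dots> = (\<integral>x. indicator B x \<partial>(law s \<bind> P t))"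
      by (rule integral_bind_kernel[symmetric]) (use assms ib l.prob_space_axioms in auto)
    also have "\<dots> = measure (law s \<bind> P t) B" using B2 by simp
    finally show "emeasure (law (s + t)) B = emeasure (law s \<bind> P t) B"
      by (simp add: l2.emeasure_eq_measure b.emeasure_eq_measure)
  qed
qed

lemma integral_law_add:
  assumes "0 \<le> s" "0 \<le> t" "f \<in> bdd_measurable \<pi> C"
  shows "(\<integral>x. f x \<partial>law (s + t)) = (\<integral>x. semigroup_op P t f x \<partial>law s)"
  unfolding law_add[OF assms(1,2)]
  using integral_bind_kernel[OF assms(2,3) prob_space_law[OF assms(1)]] by simp

lemma integral_semigroup_op_invariant:
  assumes "0 \<le> t" "f \<in> bdd_measurable \<pi> C"
  shows "(\<integral>x. semigroup_op P t f x \<partial>\<pi>) = (\<integral>x. f x \<partial>\<pi>)"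
  using integral_bind_kernel[OF assms \<pi>.prob_space_axioms] invariant[OF assms(1)] by simp

lemma semigroup_op_mono:
  assumes "0 \<le> t" "f \<in> bdd_measurable \<pi> C" "g \<in> bdd_measurable \<pi> D"
    and "\<And>x. x \<in> space \<pi> \<Longrightarrow> f x \<le> g x" and "x \<in> space \<pi>"
  shows "semigroup_op P t f x \<le> semigroup_op P t g x"
proof -
  note k = kernel_prob_space[OF assms(1,5)]
  show ?thesis
    unfolding semigroup_op_def
    by (intro integral_mono integrable_bdd_measurable[OF k assms(2)] integrable_bdd_measurable[OF k assms(3)] assms(4))
       (use sets_eq_imp_space_eq[OF k(2)] in auto)
qed

lemma semigroup_op_diff:
  assumes "0 \<le> t" "f \<in> bdd_measurable \<pi> C" "g \<in> bdd_measurable \<pi> D" "x \<in> space \<pi>"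
  shows "semigroup_op P t (\<lambda>y. f y - g y) x = semigroup_op P t f x - semigroup_op P t g x"
proof -
  note k = kernel_prob_space[OF assms(1,4)]
  show ?thesis
    unfolding semigroup_op_def
    using integrable_bdd_measurable[OF k assms(2)] integrable_bdd_measurable[OF k assms(3)]
    by (rule Bochner_Integration.integral_diff)
qed

lemma semigroup_op_abs_le:
  "\<bar>semigroup_op P t f x\<bar> \<le> semigroup_op P t (\<lambda>y. \<bar>f y\<bar>) x"
  unfolding semigroup_op_def by (rule integral_abs_bound)

text \<open>Jensen for the probability measure \<open>P t x\<close>: the gap is the variance of
  \<open>f\<close> under it. Divided by the time step, this gap becomes
  \<open>pre_\<Gamma>\<close>.\<close>

lemma semigroup_op_power2_le:
  assumes "0 \<le> t" "f \<in> bdd_measurable \<pi> C" "x \<in> space \<pi>"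
  shows "(semigroup_op P t f x)\<^sup>2 \<le> semigroup_op P t (\<lambda>y. (f y)\<^sup>2) x"
proof -
  note k = kernel_prob_space[OF assms(1,3)]
  interpret K: prob_space "P t x" by fact
  have i: "integrable (P t x) f" "integrable (P t x) (\<lambda>y. (f y)\<^sup>2)"
    using integrable_bdd_measurable[OF k assms(2)]
      integrable_bdd_measurable[OF k bdd_measurable_power2[OF assms(2)]] .
  have "0 \<le> K.variance f" by (rule K.variance_positive)
  then show ?thesis
    unfolding semigroup_op_def K.variance_eq[OF i] by simp
qed

end

section \<open>The generator and the carre du champ operator\<close>

context prob_space
begin

text \<open>The gap is the variance of \<open>\<bar>f x\<bar>\<close>. This turns the
  \<open>L2(\<pi>)\<close> limit behind the generator into \<open>L1(\<pi>)\<close> limits.\<close>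

lemma square_expectation_abs_le:
  fixes f :: "'a \<Rightarrow> real"
  assumes [measurable]: "f \<in> borel_measurable M" and "integrable M (\<lambda>x. (f x)\<^sup>2)"
  shows "(expectation (\<lambda>x. \<bar>f x\<bar>))\<^sup>2 \<le> expectation (\<lambda>x. (f x)\<^sup>2)"
proof -
  have "integrable M f" using assms by (rule square_integrable_imp_integrable)
  then have "variance (\<lambda>x. \<bar>f x\<bar>) = expectation (\<lambda>x. (f x)\<^sup>2) - (expectation (\<lambda>x. \<bar>f x\<bar>))\<^sup>2"
    using variance_eq[of "\<lambda>x. \<bar>f x\<bar>"] assms by simp
  then show ?thesis using variance_positive[of "\<lambda>x. \<bar>f x\<bar>"] by simp
qed

lemma integrable_square_add:
  fixes f g :: "'a \<Rightarrow> real"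
  assumes [measurable]: "f \<in> borel_measurable M" "g \<in> borel_measurable M"
    and "integrable M (\<lambda>x. (f x)\<^sup>2)" "integrable M (\<lambda>x. (g x)\<^sup>2)"
  shows "integrable M (\<lambda>x. (f x + g x)\<^sup>2)" "integrable M (\<lambda>x. (f x - g x)\<^sup>2)"
proof -
  have "(f x + g x)\<^sup>2 \<le> 2 * (f x)\<^sup>2 + 2 * (g x)\<^sup>2" "(f x - g x)\<^sup>2 \<le> 2 * (f x)\<^sup>2 + 2 * (g x)\<^sup>2" for x
    using zero_le_power2[of "f x - g x"] zero_le_power2[of "f x + g x"]
    by (simp_all add: power2_sum power2_diff)
  moreover have "integrable M (\<lambda>x. 2 * (f x)\<^sup>2 + 2 * (g x)\<^sup>2)"
    using assms by simp
  ultimately show "integrable M (\<lambda>x. (f x + g x)\<^sup>2)" "integrable M (\<lambda>x. (f x - g x)\<^sup>2)"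
    by (auto intro!: Bochner_Integration.integrable_bound[where f="\<lambda>x. 2 * (f x)\<^sup>2 + 2 * (g x)\<^sup>2"])
qed

end

context markov_mixing_process
begin

abbreviation L :: "('a \<Rightarrow> real) \<Rightarrow> 'a \<Rightarrow> real" where "L \<equiv> generator \<pi> P"

lemma algebra_measurable: "f \<in> \<A> \<Longrightarrow> f \<in> borel_measurable \<pi>"
  using algebra_Linf by (auto simp: Linf_space_def)

lemma has_generator_generator: "f \<in> \<A> \<Longrightarrow> has_generator \<pi> P f (L f)"
  unfolding generator_def using algebra_domain
  by (intro someI_ex[of "has_generator \<pi> P f"]) (auto simp: generator_domain_def)

lemma generator_L2:
  assumes "f \<in> \<A>"
  shows "L f \<in> borel_measurable \<pi>" "integrable \<pi> (\<lambda>x. (L f x)\<^sup>2)" "integrable \<pi> (L f)"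
  using has_generator_generator[OF assms] \<pi>.square_integrable_imp_integrable
  by (auto simp: has_generator_def L2_space_def)

lemma algebra_power2: "f \<in> \<A> \<Longrightarrow> (\<lambda>x. (f x)\<^sup>2) \<in> \<A>"
  using algebra_mult[of f f] by (simp add: power2_eq_square)

definition L_err :: "('a \<Rightarrow> real) \<Rightarrow> real \<Rightarrow> 'a \<Rightarrow> real" where
  "L_err f h x = (semigroup_op P h f x - f x) / h - L f x"

lemma integrable_bdd: "f \<in> bdd_measurable \<pi> C \<Longrightarrow> integrable \<pi> f"
  using integrable_bdd_measurable[OF \<pi>.prob_space_axioms] by blast

lemma integrable_L_err:
  assumes "f \<in> \<A>" "f \<in> bdd_measurable \<pi> C" "0 < h"
  shows "L_err f h \<in> borel_measurable \<pi>" "integrable \<pi> (\<lambda>x. (L_err f h x)\<^sup>2)" "integrable \<pi> (L_err f h)"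
proof -
  have b: "semigroup_op P h f \<in> bdd_measurable \<pi> C"
    using assms by (intro semigroup_op_bdd_measurable) auto
  note m [measurable] = bdd_measurable_measurable[OF b] bdd_measurable_measurable[OF assms(2)]
    generator_L2(1)[OF assms(1)]
  note i = integrable_bdd[OF bdd_measurable_power2[OF b]] integrable_bdd[OF bdd_measurable_power2[OF assms(2)]]
  have "integrable \<pi> (\<lambda>x. ((semigroup_op P h f x - f x) / h)\<^sup>2)"
    unfolding power_divide by (intro integrable_divide \<pi>.integrable_square_add m i)
  then show i2: "integrable \<pi> (\<lambda>x. (L_err f h x)\<^sup>2)"
    unfolding L_err_def by (intro \<pi>.integrable_square_add generator_L2 assms) measurable
  show m: "L_err f h \<in> borel_measurable \<pi>"
    unfolding L_err_def by measurable
  show "integrable \<pi> (L_err f h)"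
    using m i2 by (rule \<pi>.square_integrable_imp_integrable)
qed

lemma L_err_tendsto_0:
  assumes "f \<in> \<A>" "f \<in> bdd_measurable \<pi> C"
  shows "((\<lambda>h. \<integral>x. (L_err f h x)\<^sup>2 \<partial>\<pi>) \<longlongrightarrow> 0) (at_right 0)"
    and "((\<lambda>h. \<integral>x. \<bar>L_err f h x\<bar> \<partial>\<pi>) \<longlongrightarrow> 0) (at_right 0)"
proof -
  show *: "((\<lambda>h. \<integral>x. (L_err f h x)\<^sup>2 \<partial>\<pi>) \<longlongrightarrow> 0) (at_right 0)"
    using has_generator_generator[OF assms(1)] by (simp add: has_generator_def L_err_def)
  have "((\<lambda>h. sqrt (\<integral>x. (L_err f h x)\<^sup>2 \<partial>\<pi>)) \<longlongrightarrow> sqrt 0) (at_right 0)"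
    using * by (rule tendsto_real_sqrt)
  then have lim: "((\<lambda>h. sqrt (\<integral>x. (L_err f h x)\<^sup>2 \<partial>\<pi>)) \<longlongrightarrow> 0) (at_right 0)" by simp
  show "((\<lambda>h. \<integral>x. \<bar>L_err f h x\<bar> \<partial>\<pi>) \<longlongrightarrow> 0) (at_right 0)"
  proof (rule tendsto_sandwich[OF _ _ tendsto_const lim])
    show "\<forall>\<^sub>F h in at_right 0. (\<integral>x. \<bar>L_err f h x\<bar> \<partial>\<pi>) \<le> sqrt (\<integral>x. (L_err f h x)\<^sup>2 \<partial>\<pi>)"
      using eventually_at_right_less
    proof eventually_elim
      case (elim h)
      then show ?case
        using \<pi>.square_expectation_abs_le[of "L_err f h"] integrable_L_err[OF assms elim]
        by (intro real_le_rsqrt) auto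
    qed
  qed simp
qed

section \<open>Continuity of the semigroup at time 0 in \<open>L1(\<pi>)\<close>\<close>

lemma semigroup_op_L1_continuous_algebra:
  assumes "f \<in> \<A>" "f \<in> bdd_measurable \<pi> C"
  shows "((\<lambda>h. \<integral>x. \<bar>semigroup_op P h f x - f x\<bar> \<partial>\<pi>) \<longlongrightarrow> 0) (at_right 0)"
proof -
  have "((\<lambda>h. h * ((\<integral>x. \<bar>L_err f h x\<bar> \<partial>\<pi>) + (\<integral>x. \<bar>L f x\<bar> \<partial>\<pi>)))
      \<longlongrightarrow> 0 * (0 + (\<integral>x. \<bar>L f x\<bar> \<partial>\<pi>))) (at_right 0)"
    by (intro tendsto_intros L_err_tendsto_0[OF assms])
  then have lim: "((\<lambda>h. h * ((\<integral>x. \<bar>L_err f h x\<bar> \<partial>\<pi>) + (\<integral>x. \<bar>L f x\<bar> \<partial>\<pi>))) \<longlongrightarrow> 0) (at_right 0)"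
    by simp
  show ?thesis
  proof (rule tendsto_sandwich[OF _ _ tendsto_const lim])
    show "\<forall>\<^sub>F h in at_right 0. (\<integral>x. \<bar>semigroup_op P h f x - f x\<bar> \<partial>\<pi>)
        \<le> h * ((\<integral>x. \<bar>L_err f h x\<bar> \<partial>\<pi>) + (\<integral>x. \<bar>L f x\<bar> \<partial>\<pi>))"
      using eventually_at_right_less
    proof eventually_elim
      case (elim h)
      note i = integrable_L_err(3)[OF assms elim] generator_L2(3)[OF assms(1)]
      have b: "semigroup_op P h f \<in> bdd_measurable \<pi> C"
        using assms elim by (intro semigroup_op_bdd_measurable) auto
      have "(\<integral>x. \<bar>semigroup_op P h f x - f x\<bar> \<partial>\<pi>) \<le> (\<integral>x. h * (\<bar>L_err f h x\<bar> + \<bar>L f x\<bar>) \<partial>\<pi>)"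
      proof (rule integral_mono)
        show "integrable \<pi> (\<lambda>x. \<bar>semigroup_op P h f x - f x\<bar>)"
          using integrable_bdd[OF b] integrable_bdd[OF assms(2)] by simp
        show "integrable \<pi> (\<lambda>x. h * (\<bar>L_err f h x\<bar> + \<bar>L f x\<bar>))" using i by simp
        fix x
        have "\<bar>semigroup_op P h f x - f x\<bar> = h * \<bar>L_err f h x + L f x\<bar>"
          using elim by (simp add: L_err_def abs_mult flip: abs_mult_pos')
        also have "\<dots> \<le> h * (\<bar>L_err f h x\<bar> + \<bar>L f x\<bar>)" using elim by simp
        finally show "\<bar>semigroup_op P h f x - f x\<bar> \<le> h * (\<bar>L_err f h x\<bar> + \<bar>L f x\<bar>)" .
      qed
      also have "\<dots> = h * ((\<integral>x. \<bar>L_err f h x\<bar> \<partial>\<pi>) + (\<integral>x. \<bar>L f x\<bar> \<partial>\<pi>))"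
        using i by simp
      finally show ?case .
    qed
  qed simp
qed

text \<open>Elements of \<open>\<A>\<close> are bounded only almost everywhere. Clipping gives a
  bound at every point, as kernels and the initial law require, and \<open>algebra_AE\<close> keeps
  the clipped function in \<open>\<A>\<close>.\<close>

lemma algebra_bounded_representative:
  assumes "f \<in> \<A>"
  obtains g C where "g \<in> \<A>" "g \<in> bdd_measurable \<pi> C" "AE x in \<pi>. f x = g x"
proof -
  obtain C where C: "AE x in \<pi>. \<bar>f x\<bar> \<le> C"
    using algebra_Linf assms by (auto simp: Linf_space_def)
  note [measurable] = algebra_measurable[OF assms]
  define g where "g x = max (- \<bar>C\<bar>) (min \<bar>C\<bar> (f x))" for x
  have m [measurable]: "g \<in> borel_measurable \<pi>" unfolding g_def by measurable
  have ae: "AE x in \<pi>. f x = g x" using C by eventually_elim (auto simp: g_def)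
  have "g \<in> bdd_measurable \<pi> \<bar>C\<bar>"
    using m by (auto simp: bdd_measurable_def g_def)
  then show thesis using that algebra_AE[OF assms m ae] ae by blast
qed

lemma algebra_L1_dense:
  assumes "f \<in> bdd_measurable \<pi> C" "0 < e"
  obtains g D where "g \<in> \<A>" "g \<in> bdd_measurable \<pi> D" "(\<integral>x. \<bar>f x - g x\<bar> \<partial>\<pi>) < e"
proof -
  have fL2: "f \<in> L2_space \<pi>"
    using bdd_measurable_measurable[OF assms(1)] integrable_bdd[OF bdd_measurable_power2[OF assms(1)]]
    by (simp add: L2_space_def)
  then obtain g0 where g0: "g0 \<in> \<A>" "(\<integral>x. (f x - g0 x)\<^sup>2 \<partial>\<pi>) < e\<^sup>2"
    using algebra_dense[of f "e\<^sup>2"] assms(2) by auto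
  obtain g D where g: "g \<in> \<A>" "g \<in> bdd_measurable \<pi> D" "AE x in \<pi>. g0 x = g x"
    using algebra_bounded_representative[OF g0(1)] .
  note [measurable] = bdd_measurable_measurable[OF assms(1)] bdd_measurable_measurable[OF g(2)]
    algebra_measurable[OF g0(1)]
  have "(\<integral>x. \<bar>f x - g x\<bar> \<partial>\<pi>)\<^sup>2 \<le> (\<integral>x. (f x - g x)\<^sup>2 \<partial>\<pi>)"
    using integrable_bdd[OF bdd_measurable_power2[OF assms(1)]] integrable_bdd[OF bdd_measurable_power2[OF g(2)]]
    by (intro \<pi>.square_expectation_abs_le \<pi>.integrable_square_add) measurable
  also have "\<dots> = (\<integral>x. (f x - g0 x)\<^sup>2 \<partial>\<pi>)"
    using g(3) by (intro integral_cong_AE) auto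
  also have "\<dots> < e\<^sup>2" by fact
  finally have "(\<integral>x. \<bar>f x - g x\<bar> \<partial>\<pi>) < e"
    using assms(2) by (intro power2_less_imp_less[of _ e]) auto
  then show thesis using that g by blast
qed

text \<open>\<open>P\<^sub>h\<close> of the absolute value dominates the absolute value of
  \<open>P\<^sub>h f\<close>, and its \<open>\<pi>\<close>-integral is preserved by
  invariance.\<close>

lemma semigroup_op_L1_contraction:
  assumes "0 \<le> h" "f \<in> bdd_measurable \<pi> C"
  shows "(\<integral>x. \<bar>semigroup_op P h f x\<bar> \<partial>\<pi>) \<le> (\<integral>x. \<bar>f x\<bar> \<partial>\<pi>)"
proof -
  have a: "(\<lambda>x. \<bar>f x\<bar>) \<in> bdd_measurable \<pi> C"
    using assms(2) by (auto simp: bdd_measurable_def)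
  have "(\<integral>x. \<bar>semigroup_op P h f x\<bar> \<partial>\<pi>) \<le> (\<integral>x. semigroup_op P h (\<lambda>y. \<bar>f y\<bar>) x \<partial>\<pi>)"
    using integrable_bdd[OF semigroup_op_bdd_measurable[OF assms]]
      integrable_bdd[OF semigroup_op_bdd_measurable[OF assms(1) a]]
    by (intro integral_mono semigroup_op_abs_le) auto
  also have "\<dots> = (\<integral>x. \<bar>f x\<bar> \<partial>\<pi>)"
    using integral_semigroup_op_invariant[OF assms(1) a] .
  finally show ?thesis .
qed

text \<open>Contraction makes the error of approximating \<open>f\<close> from \<open>\<A>\<close>
  uniform in \<open>h\<close>. The extension beyond \<open>\<A>\<close> serves truncations of
  \<open>\<Gamma> f\<close>, which are bounded but need not lie in the algebra.\<close>

lemma semigroup_op_L1_continuous: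
  assumes "f \<in> bdd_measurable \<pi> C"
  shows "((\<lambda>h. \<integral>x. \<bar>semigroup_op P h f x - f x\<bar> \<partial>\<pi>) \<longlongrightarrow> 0) (at_right 0)"
proof (rule order_tendstoI)
  fix e :: real assume "0 < e"
  then obtain g D where g: "g \<in> \<A>" "g \<in> bdd_measurable \<pi> D" and fg: "(\<integral>x. \<bar>f x - g x\<bar> \<partial>\<pi>) < e / 3"
    using algebra_L1_dense[OF assms, of "e / 3"] by auto
  have "\<forall>\<^sub>F h in at_right 0. (\<integral>x. \<bar>semigroup_op P h g x - g x\<bar> \<partial>\<pi>) < e / 3"
    using semigroup_op_L1_continuous_algebra[OF g] \<open>0 < e\<close> by (intro order_tendstoD) auto
  then show "\<forall>\<^sub>F h in at_right 0. (\<integral>x. \<bar>semigroup_op P h f x - f x\<bar> \<partial>\<pi>) < e"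
    using eventually_at_right_less
  proof eventually_elim
    case (elim h)
    have h: "0 \<le> h" using elim by simp
    have d: "(\<lambda>x. f x - g x) \<in> bdd_measurable \<pi> (C + D)"
    proof -
      have "\<bar>f x - g x\<bar> \<le> C + D" if "x \<in> space \<pi>" for x
        using bdd_measurable_bound[OF assms that] bdd_measurable_bound[OF g(2) that] by linarith
      then show ?thesis
        using bdd_measurable_measurable[OF assms] bdd_measurable_measurable[OF g(2)]
        by (auto simp: bdd_measurable_def)
    qed
    note i = integrable_bdd[OF semigroup_op_bdd_measurable[OF h d]] integrable_bdd[OF d]
      integrable_bdd[OF semigroup_op_bdd_measurable[OF h g(2)]] integrable_bdd[OF g(2)]
      integrable_bdd[OF semigroup_op_bdd_measurable[OF h assms]] integrable_bdd[OF assms]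
    have "(\<integral>x. \<bar>semigroup_op P h f x - f x\<bar> \<partial>\<pi>)
        \<le> (\<integral>x. \<bar>semigroup_op P h (\<lambda>y. f y - g y) x\<bar> + \<bar>semigroup_op P h g x - g x\<bar> + \<bar>f x - g x\<bar> \<partial>\<pi>)"
      using i semigroup_op_diff[OF h assms g(2)] by (intro integral_mono) auto
    also have "\<dots> = (\<integral>x. \<bar>semigroup_op P h (\<lambda>y. f y - g y) x\<bar> \<partial>\<pi>)
        + (\<integral>x. \<bar>semigroup_op P h g x - g x\<bar> \<partial>\<pi>) + (\<integral>x. \<bar>f x - g x\<bar> \<partial>\<pi>)"
      using i by simp
    also have "\<dots> < e"
      using semigroup_op_L1_contraction[OF h d] fg elim by simp
    finally show ?case .
  qed
qed (auto intro!: always_eventually order.strict_trans2[OF _ Bochner_Integration.integral_nonneg])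

section \<open>Difference quotients of the carre du champ\<close>

abbreviation \<Gamma> :: "('a \<Rightarrow> real) \<Rightarrow> 'a \<Rightarrow> real" where "\<Gamma> \<equiv> carre_du_champ \<pi> P"

text \<open>The variance of \<open>f\<close> under \<open>P h x\<close> per unit of time. With
  \<open>(P\<^sub>h f)\<^sup>2\<close> subtracted, it is pointwise nonnegative and is also the exact
  increment of second moments along the flow, see \<open>integral_square_increment\<close>.\<close>

definition pre_\<Gamma> :: "('a \<Rightarrow> real) \<Rightarrow> real \<Rightarrow> 'a \<Rightarrow> real" where
  "pre_\<Gamma> f h x = (semigroup_op P h (\<lambda>y. (f y)\<^sup>2) x - (semigroup_op P h f x)\<^sup>2) / h"

lemma pre_\<Gamma>_nonneg:
  "0 < h \<Longrightarrow> f \<in> bdd_measurable \<pi> C \<Longrightarrow> x \<in> space \<pi> \<Longrightarrow> 0 \<le> pre_\<Gamma> f h x"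
  using semigroup_op_power2_le[of h f C x] by (simp add: pre_\<Gamma>_def)

lemma pre_\<Gamma>_bdd_measurable:
  assumes "0 < h" "f \<in> bdd_measurable \<pi> C"
  shows "pre_\<Gamma> f h \<in> bdd_measurable \<pi> (C\<^sup>2 / h)"
proof -
  have b: "semigroup_op P h (\<lambda>y. (f y)\<^sup>2) \<in> bdd_measurable \<pi> (C\<^sup>2)" "semigroup_op P h f \<in> bdd_measurable \<pi> C"
    using assms by (auto intro!: semigroup_op_bdd_measurable bdd_measurable_power2)
  note [measurable] = b[THEN bdd_measurable_measurable]
  have "\<bar>pre_\<Gamma> f h x\<bar> \<le> C\<^sup>2 / h" if "x \<in> space \<pi>" for x
  proof -
    have "\<bar>pre_\<Gamma> f h x\<bar> = pre_\<Gamma> f h x" using pre_\<Gamma>_nonneg assms that by simp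
    also have "\<dots> \<le> C\<^sup>2 / h"
      using bdd_measurable_bound[OF b(1) that] zero_le_power2[of "semigroup_op P h f x"] assms(1)
      unfolding pre_\<Gamma>_def by (intro divide_right_mono) linarith+
    finally show ?thesis .
  qed
  then show ?thesis
    unfolding bdd_measurable_def by (auto simp: pre_\<Gamma>_def[abs_def])
qed

lemma \<Gamma>_integrable:
  assumes "f \<in> \<A>" "f \<in> bdd_measurable \<pi> C"
  shows "integrable \<pi> (\<Gamma> f)"
  unfolding carre_du_champ_def[abs_def]
proof (intro Bochner_Integration.integrable_diff integrable_mult_right)
  show "integrable \<pi> (L (\<lambda>y. (f y)\<^sup>2))" using assms by (intro generator_L2 algebra_power2)
  show "integrable \<pi> (\<lambda>x. f x * L f x)"
    using generator_L2(1,3)[OF assms(1)] bdd_measurable_measurable[OF assms(2)] bdd_measurable_bound[OF assms(2)]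
    by (intro Bochner_Integration.integrable_bound[of \<pi> "\<lambda>x. C * L f x" "\<lambda>x. f x * L f x"])
       (auto simp: abs_mult intro!: mult_right_mono AE_I2 intro: order_trans[OF _ abs_ge_self])
qed

text \<open>Both \<open>f\<close> and its square lie in \<open>\<A>\<close>, so both generator
  limits are available; their errors and a remainder of order \<open>h\<close> bound the
  difference.\<close>

lemma pre_\<Gamma>_tendsto:
  assumes A: "f \<in> \<A>" and b: "f \<in> bdd_measurable \<pi> C"
  shows "((\<lambda>h. \<integral>x. \<bar>pre_\<Gamma> f h x - 2 * \<Gamma> f x\<bar> \<partial>\<pi>) \<longlongrightarrow> 0) (at_right 0)"
proof -
  note A2 = algebra_power2[OF A] and b2 = bdd_measurable_power2[OF b]
  define B where "B h = (\<integral>x. \<bar>L_err (\<lambda>y. (f y)\<^sup>2) h x\<bar> \<partial>\<pi>) + 2 * C * (\<integral>x. \<bar>L_err f h x\<bar> \<partial>\<pi>)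
      + h * (3 / 2 * (\<integral>x. (L f x)\<^sup>2 \<partial>\<pi>) + (\<integral>x. (L_err f h x)\<^sup>2 \<partial>\<pi>))" for h
  have "(B \<longlongrightarrow> 0 + 2 * C * 0 + 0 * (3 / 2 * (\<integral>x. (L f x)\<^sup>2 \<partial>\<pi>) + 0)) (at_right 0)"
    unfolding B_def by (intro tendsto_intros L_err_tendsto_0[OF A b] L_err_tendsto_0[OF A2 b2])
  then have lim: "(B \<longlongrightarrow> 0) (at_right 0)" by simp
  show ?thesis
  proof (rule tendsto_sandwich[OF _ _ tendsto_const lim])
    show "\<forall>\<^sub>F h in at_right 0. (\<integral>x. \<bar>pre_\<Gamma> f h x - 2 * \<Gamma> f x\<bar> \<partial>\<pi>) \<le> B h"
      using eventually_at_right_less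
    proof eventually_elim
      case (elim h)
      note i = integrable_L_err[OF A b elim] integrable_L_err[OF A2 b2 elim] generator_L2[OF A]
      have "(\<integral>x. \<bar>pre_\<Gamma> f h x - 2 * \<Gamma> f x\<bar> \<partial>\<pi>)
          \<le> (\<integral>x. \<bar>L_err (\<lambda>y. (f y)\<^sup>2) h x\<bar> + 2 * C * \<bar>L_err f h x\<bar>
              + h * (3 / 2 * (L f x)\<^sup>2 + (L_err f h x)\<^sup>2) \<partial>\<pi>)"
      proof (rule integral_mono)
        show "integrable \<pi> (\<lambda>x. \<bar>pre_\<Gamma> f h x - 2 * \<Gamma> f x\<bar>)"
          using \<Gamma>_integrable[OF A b] integrable_bdd[OF pre_\<Gamma>_bdd_measurable[OF elim b]] by simp
        show "integrable \<pi> (\<lambda>x. \<bar>L_err (\<lambda>y. (f y)\<^sup>2) h x\<bar> + 2 * C * \<bar>L_err f h x\<bar>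
              + h * (3 / 2 * (L f x)\<^sup>2 + (L_err f h x)\<^sup>2))"
          using i by simp
        fix x assume x: "x \<in> space \<pi>"
        \<comment> \<open>Factoring \<open>p\<^sup>2 - q\<^sup>2\<close> leaves
          \<open>e * (p + q)\<close>, where \<open>p + q\<close> is at most \<open>2 * C\<close> in
          absolute value, and \<open>h * (l * (e + l))\<close>, which square integrability of
          \<open>l\<close> and \<open>e\<close> controls.\<close>
        define p q l e where "p = semigroup_op P h f x" and "q = f x" and "l = L f x" and "e = L_err f h x"
        have pq: "p = q + h * (e + l)"
          using elim by (simp add: p_def q_def l_def e_def L_err_def)
        have "pre_\<Gamma> f h x - 2 * \<Gamma> f x = L_err (\<lambda>y. (f y)\<^sup>2) h x - ((p\<^sup>2 - q\<^sup>2) / h - 2 * q * l)"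
          using elim by (simp add: pre_\<Gamma>_def carre_du_champ_def L_err_def p_def q_def l_def field_simps)
        also have "(p\<^sup>2 - q\<^sup>2) / h = (e + l) * (p + q)"
          unfolding power2_eq_square square_diff_square_factored using elim by (simp add: pq)
        also have "(e + l) * (p + q) - 2 * q * l = e * (p + q) + h * (l * (e + l))"
          by (simp add: pq algebra_simps)
        finally have eq: "pre_\<Gamma> f h x - 2 * \<Gamma> f x
            = L_err (\<lambda>y. (f y)\<^sup>2) h x - (e * (p + q) + h * (l * (e + l)))" .
        have "\<bar>p\<bar> \<le> C" "\<bar>q\<bar> \<le> C"
          using bdd_measurable_bound[OF b x] bdd_measurable_bound[OF semigroup_op_bdd_measurable[OF _ b] x] elim
          by (auto simp: p_def q_def)
        then have "\<bar>e * (p + q)\<bar> \<le> \<bar>e\<bar> * (2 * C)"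
          unfolding abs_mult by (intro mult_left_mono) linarith+
        moreover have "\<bar>l * (e + l)\<bar> \<le> 3 / 2 * l\<^sup>2 + e\<^sup>2"
        proof -
          have "0 \<le> (l / 2 - e)\<^sup>2 + 1/4 * l\<^sup>2" "0 \<le> (l / 2 + e)\<^sup>2 + 9/4 * l\<^sup>2" by simp_all
          then show ?thesis by (simp add: abs_le_iff power2_eq_square algebra_simps)
        qed
        then have "\<bar>h * (l * (e + l))\<bar> \<le> h * (3 / 2 * l\<^sup>2 + e\<^sup>2)"
          unfolding abs_mult using elim by (simp add: abs_mult)
        ultimately show "\<bar>pre_\<Gamma> f h x - 2 * \<Gamma> f x\<bar> \<le> \<bar>L_err (\<lambda>y. (f y)\<^sup>2) h x\<bar> + 2 * C * \<bar>L_err f h x\<bar>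
              + h * (3 / 2 * (L f x)\<^sup>2 + (L_err f h x)\<^sup>2)"
          unfolding eq l_def[symmetric] e_def[symmetric] by (simp add: mult.commute)
      qed
      also have "\<dots> = B h" using i by (simp add: B_def)
      finally show ?case .
    qed
  qed simp
qed

end

section \<open>Variance decay along the flow\<close>

text \<open>
  Monotonicity stands in for continuity: it alone carries the bound down to the infimum \<open>m\<close> of the
  set of good times, and the Dini condition at \<open>m\<close> then pushes it below \<open>m\<close>.
\<close>

lemma left_Dini_growth:
  fixes \<psi> :: "real \<Rightarrow> real"
  assumes nonneg: "\<And>s. 0 \<le> s \<Longrightarrow> s \<le> t \<Longrightarrow> 0 \<le> \<psi> s"
    and mono: "\<And>r s. 0 \<le> r \<Longrightarrow> r \<le> s \<Longrightarrow> s \<le> t \<Longrightarrow> \<psi> r \<le> \<psi> s"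
    and a: "0 \<le> a" and t: "0 \<le> t"
    and Dini: "\<And>s e. 0 < s \<Longrightarrow> s \<le> t \<Longrightarrow> 0 < e \<Longrightarrow>
      \<forall>\<^sub>F h in at_right 0. h * (a * \<psi> s - e) \<le> \<psi> s - \<psi> (s - h)"
  shows "\<psi> 0 \<le> exp (- (a * t)) * \<psi> t"
proof (rule field_le_epsilon)
  fix e :: real assume e: "0 < e"
  \<comment> \<open>The slack is spent linearly in time at rate \<open>\<eta>\<close>, at most
    \<open>e\<close> in total; the same \<open>\<eta>\<close> is the tolerance in the Dini
    condition.\<close>
  define \<eta> where "\<eta> = e / (t + 1)"
  have \<eta>: "0 < \<eta>" using e t by (simp add: \<eta>_def)
  define k where "k s = exp (- (a * s)) * \<psi> s" for s
  define S where "S = {s. 0 \<le> s \<and> s \<le> t \<and> (\<forall>r. s \<le> r \<longrightarrow> r \<le> t \<longrightarrow> k r \<le> k t + \<eta> * (t - r))}"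
  have tS: "t \<in> S" using t by (auto simp: S_def)
  have bdd: "bdd_below S" by (auto simp: S_def intro: bdd_belowI[of _ 0])
  define m where "m = Inf S"
  have m0: "0 \<le> m" unfolding m_def using tS by (intro cInf_greatest) (auto simp: S_def)
  have mt: "m \<le> t" unfolding m_def using tS bdd by (intro cInf_lower)
  have above: "k r \<le> k t + \<eta> * (t - r)" if "m < r" "r \<le> t" for r
  proof -
    have "\<exists>s\<in>S. s < r"
      by (rule cInf_lessD) (use tS that(1) in \<open>auto simp: m_def\<close>)
    then obtain s where "s \<in> S" "s < r" by blast
    then show ?thesis using that(2) by (auto simp: S_def)
  qed
  have at_m: "k m \<le> k t + \<eta> * (t - m)"
  proof (cases "m = t")
    case False
    then have mt': "m < t" using mt by simp
    have ev: "\<forall>\<^sub>F r in at_right m. \<psi> m \<le> exp (a * r) * (k t + \<eta> * (t - r))"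
    proof (rule eventually_at_rightI[OF _ mt'])
      fix r assume elim: "r \<in> {m<..<t}"
      have "\<psi> m \<le> \<psi> r" using elim m0 by (intro mono) auto
      also have "\<psi> r = exp (a * r) * k r" by (simp add: k_def exp_minus)
      also have "\<dots> \<le> exp (a * r) * (k t + \<eta> * (t - r))"
        using above[of r] elim by simp
      finally show "\<psi> m \<le> exp (a * r) * (k t + \<eta> * (t - r))" .
    qed
    have "((\<lambda>r. exp (a * r) * (k t + \<eta> * (t - r))) \<longlongrightarrow> exp (a * m) * (k t + \<eta> * (t - m))) (at_right m)"
      by (intro tendsto_intros)
    then have "\<psi> m \<le> exp (a * m) * (k t + \<eta> * (t - m))"
      by (rule tendsto_lowerbound[OF _ ev]) simp
    then show ?thesis by (simp add: k_def exp_minus field_simps)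
  qed simp
  have "m = 0"
  proof (rule ccontr)
    assume "m \<noteq> 0"
    then have mpos: "0 < m" using m0 by simp
    obtain d where d: "0 < d" and dh: "\<And>h. 0 < h \<Longrightarrow> h < d \<Longrightarrow> h * (a * \<psi> m - \<eta>) \<le> \<psi> m - \<psi> (m - h)"
      using Dini[OF mpos mt \<eta>] unfolding eventually_at_right_field by auto
    define h0 where "h0 = min d m / 2"
    have h0: "0 < h0" "h0 < d" "h0 < m" using d mpos by (auto simp: h0_def min_def)
    \<comment> \<open>One Dini step back from \<open>m\<close>. Since
      \<open>1 - x \<le> exp (- x)\<close>, the factor \<open>1 - a * h\<close> is absorbed by the
      weight of \<open>k\<close>. As \<open>h\<close> stays below \<open>m\<close>, the weight is at
      most 1 and does not amplify \<open>\<eta>\<close>.\<close>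
    have ext: "k (m - h) \<le> k m + \<eta> * h" if "0 < h" "h \<le> h0" for h
    proof -
      have "\<psi> (m - h) \<le> (1 - a * h) * \<psi> m + \<eta> * h"
        using dh[of h] that h0 by (simp add: algebra_simps)
      then have "exp (- (a * m)) * exp (a * h) * \<psi> (m - h)
          \<le> exp (- (a * m)) * exp (a * h) * ((1 - a * h) * \<psi> m + \<eta> * h)"
        by (intro mult_left_mono) auto
      moreover have "k (m - h) = exp (- (a * m)) * exp (a * h) * \<psi> (m - h)"
        by (simp add: k_def algebra_simps flip: exp_add)
      ultimately have "k (m - h) \<le> exp (- (a * m)) * exp (a * h) * ((1 - a * h) * \<psi> m + \<eta> * h)"
        by simp
      also have "\<dots> = exp (- (a * m)) * \<psi> m * (exp (a * h) * (1 - a * h)) + exp (a * (h - m)) * (\<eta> * h)"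
        by (simp add: algebra_simps flip: exp_add)
      also have "\<dots> \<le> exp (- (a * m)) * \<psi> m * 1 + 1 * (\<eta> * h)"
      proof (intro add_mono mult_left_mono mult_right_mono)
        have "1 - a * h \<le> exp (- (a * h))" using exp_ge_add_one_self[of "- (a * h)"] by simp
        then show "exp (a * h) * (1 - a * h) \<le> 1"
          using mult_left_mono[of _ _ "exp (a * h)"] by (fastforce simp flip: exp_add)
        show "exp (a * (h - m)) \<le> 1" using a that h0 by (simp add: mult_nonneg_nonpos)
      qed (use nonneg[OF m0 mt] \<eta> that in auto)
      finally show ?thesis by (simp add: k_def)
    qed
    have "m - h0 \<in> S"
      unfolding S_def
    proof (intro CollectI conjI allI impI)
      fix r assume r: "m - h0 \<le> r" "r \<le> t"
      consider "r < m" | "r = m" | "m < r" by linarith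
      then show "k r \<le> k t + \<eta> * (t - r)"
      proof cases
        case 1
        then show ?thesis using ext[of "m - r"] r at_m by (simp add: algebra_simps)
      qed (use at_m above r in auto)
    qed (use h0 mt in auto)
    then have "m \<le> m - h0" unfolding m_def using bdd by (intro cInf_lower)
    then show False using h0 by simp
  qed
  then have "\<psi> 0 \<le> k t + \<eta> * t" using at_m by (simp add: k_def)
  also have "\<eta> * t \<le> e" using e t by (simp add: \<eta>_def field_simps)
  finally show "\<psi> 0 \<le> exp (- (a * t)) * \<psi> t + e" by (simp add: k_def)
qed

section \<open>Passing from \<open>\<pi>\<close> to the laws by truncating densities\<close>

lemma (in prob_space) obtain_real_density:
  assumes "prob_space N" "absolutely_continuous M N" "sets N = sets M"
  obtains D :: "'a \<Rightarrow> real" where "D \<in> borel_measurable M" "\<And>x. 0 \<le> D x" "integrable M D" "N = density M D"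
proof -
  interpret N: prob_space N by fact
  obtain D where D [measurable]: "D \<in> borel_measurable M" and ae: "AE x in M. RN_deriv M N x = ennreal (D x)"
    and nn: "\<And>x. 0 \<le> D x"
    using real_RN_deriv[OF N.finite_measure_axioms assms(2,3)] by blast
  have eq: "N = density M D"
    using density_RN_deriv[OF assms(2,3)] density_cong[OF borel_measurable_RN_deriv _ ae] by simp
  have "(\<integral>\<^sup>+x. ennreal (D x) \<partial>M) = emeasure N (space N)"
    unfolding eq by (simp add: emeasure_density nn_integral_set_ennreal[symmetric] cong: nn_integral_cong)
  also have "\<dots> = 1" by (rule N.emeasure_space_1)
  finally have "integrable M D"
    using nn by (intro integrableI_nonneg) auto
  then show thesis using that D nn eq by blast
qed

text \<open>Truncate the density at a level \<open>n\<close>: the lower part contributes at most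
  \<open>n\<close> times the integral under \<open>M\<close>, the excess has small mass and meets
  the bound \<open>B\<close>. The level serves all \<open>a\<close> at once.\<close>

lemma (in prob_space) integral_le_truncated_density:
  assumes N: "prob_space N" "absolutely_continuous M N" "sets N = sets M" and "0 < e" "0 \<le> B"
  obtains K where "0 \<le> K"
    "\<And>a. a \<in> bdd_measurable M B \<Longrightarrow> (\<And>x. x \<in> space M \<Longrightarrow> 0 \<le> a x) \<Longrightarrow>
        (\<integral>x. a x \<partial>N) \<le> K * (\<integral>x. a x \<partial>M) + e"
proof -
  obtain D :: "'a \<Rightarrow> real" where D [measurable]: "D \<in> borel_measurable M" and D0: "\<And>x. 0 \<le> D x"
    and Di: "integrable M D" and eq: "N = density M D"
    using obtain_real_density[OF N] by blast
  have ti: "integrable M (\<lambda>x. D x - min (D x) (real n))" for n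
    by (rule Bochner_Integration.integrable_bound[OF Di]) (use D0 in \<open>auto simp: min_def\<close>)
  have "(\<lambda>n. \<integral>x. D x - min (D x) (real n) \<partial>M) \<longlonglongrightarrow> (\<integral>x. 0 \<partial>M)"
  proof (rule integral_dominated_convergence[where w=D])
    show "AE x in M. (\<lambda>n. D x - min (D x) (real n)) \<longlonglongrightarrow> 0"
    proof (rule AE_I2)
      fix x
      have "\<forall>\<^sub>F n in sequentially. D x - min (D x) (real n) = 0"
        using eventually_ge_at_top[of "nat \<lceil>D x\<rceil>"]
        by eventually_elim (auto simp: min_def nat_le_iff ceiling_le_iff)
      then show "(\<lambda>n. D x - min (D x) (real n)) \<longlonglongrightarrow> 0" by (rule tendsto_eventually)
    qed
    show "AE x in M. norm (D x - min (D x) (real n)) \<le> D x" for n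
      using D0 by (auto simp: min_def)
  qed (use Di in auto)
  \<comment> \<open>The \<open>+ 1\<close> keeps the denominator positive when
    \<open>B = 0\<close>.\<close>
  then have "\<forall>\<^sub>F n in sequentially. (\<integral>x. D x - min (D x) (real n) \<partial>M) < e / (B + 1)"
    using assms(4,5) by (intro order_tendstoD) auto
  then obtain n where n: "(\<integral>x. D x - min (D x) (real n) \<partial>M) < e / (B + 1)"
    by (auto simp: eventually_sequentially)
  show thesis
  proof (rule that)
    show "0 \<le> real n" by simp
    fix a assume a: "a \<in> bdd_measurable M B" and a0: "\<And>x. x \<in> space M \<Longrightarrow> 0 \<le> a x"
    note am [measurable] = bdd_measurable_measurable[OF a]
    have ai: "integrable M a" "integrable N a"
      using integrable_bdd_measurable[OF prob_space_axioms refl a] integrable_bdd_measurable[OF N(1,3) a] .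
    have Dai: "integrable M (\<lambda>x. D x * a x)"
      using ai(2) D0 unfolding eq by (subst (asm) integrable_density) auto
    have "(\<integral>x. a x \<partial>N) = (\<integral>x. D x * a x \<partial>M)"
      unfolding eq using D0 by (subst integral_density) auto
    also have "\<dots> \<le> (\<integral>x. real n * a x + (D x - min (D x) (real n)) * B \<partial>M)"
    proof (rule integral_mono)
      fix x assume x: "x \<in> space M"
      have "D x * a x = min (D x) (real n) * a x + (D x - min (D x) (real n)) * a x"
        by (simp add: algebra_simps)
      also have "\<dots> \<le> real n * a x + (D x - min (D x) (real n)) * B"
        using a0[OF x] bdd_measurable_bound[OF a x] by (intro add_mono mult_right_mono mult_left_mono) auto
      finally show "D x * a x \<le> real n * a x + (D x - min (D x) (real n)) * B" .
    qed (use Dai ai ti in auto)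
    also have "\<dots> = real n * (\<integral>x. a x \<partial>M) + (\<integral>x. D x - min (D x) (real n) \<partial>M) * B"
      using ai ti by simp
    also have "\<dots> \<le> real n * (\<integral>x. a x \<partial>M) + e / (B + 1) * B"
      using n assms(5) by (intro add_left_mono mult_right_mono) auto
    also have "e / (B + 1) * B \<le> e"
      using assms(4,5) by (simp add: field_simps)
    finally show "(\<integral>x. a x \<partial>N) \<le> real n * (\<integral>x. a x \<partial>M) + e" by simp
  qed
qed

context markov_mixing_process
begin

text \<open>All these laws are images of the single law at time \<open>u / 2\<close> under the
  semigroup, which preserves bounds, signs and \<open>\<pi>\<close>-integrals. One truncation level
  at \<open>u / 2\<close> therefore works for every \<open>h\<close>.\<close>

lemma law_uniformly_integrable:
  assumes u: "0 < u" and "0 < e" "0 \<le> B"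
  obtains K where "0 \<le> K"
    "\<And>h a. 0 \<le> h \<Longrightarrow> h \<le> u / 2 \<Longrightarrow> a \<in> bdd_measurable \<pi> B \<Longrightarrow>
        (\<And>x. x \<in> space \<pi> \<Longrightarrow> 0 \<le> a x) \<Longrightarrow> (\<integral>x. a x \<partial>law (u - h)) \<le> K * (\<integral>x. a x \<partial>\<pi>) + e"
proof -
  have u2: "0 < u / 2" using u by simp
  obtain K where K: "0 \<le> K" "\<And>a. a \<in> bdd_measurable \<pi> B \<Longrightarrow> (\<And>x. x \<in> space \<pi> \<Longrightarrow> 0 \<le> a x) \<Longrightarrow>
        (\<integral>x. a x \<partial>law (u / 2)) \<le> K * (\<integral>x. a x \<partial>\<pi>) + e"
    using \<pi>.integral_le_truncated_density[OF prob_space_law law_ac[OF u2], of e B] u assms(2,3) by auto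
  show thesis
  proof (rule that[OF K(1)])
    fix h a assume h: "0 \<le> h" "h \<le> u / 2" and a: "a \<in> bdd_measurable \<pi> B"
      and a0: "\<And>x. x \<in> space \<pi> \<Longrightarrow> 0 \<le> a x"
    have h': "0 \<le> u / 2 - h" using h by simp
    have "(\<integral>x. a x \<partial>law (u - h)) = (\<integral>x. semigroup_op P (u / 2 - h) a x \<partial>law (u / 2))"
      using integral_law_add[OF less_imp_le[OF u2] h' a] by simp
    also have "\<dots> \<le> K * (\<integral>x. semigroup_op P (u / 2 - h) a x \<partial>\<pi>) + e"
    proof (rule K(2)[OF semigroup_op_bdd_measurable[OF h' a]])
      fix x assume "x \<in> space \<pi>"
      then show "0 \<le> semigroup_op P (u / 2 - h) a x"
        using semigroup_op_mono[OF h' _ a, of "\<lambda>_. 0" 0 x] a0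
        by (simp add: semigroup_op_def bdd_measurable_def)
    qed
    finally show "(\<integral>x. a x \<partial>law (u - h)) \<le> K * (\<integral>x. a x \<partial>\<pi>) + e"
      using integral_semigroup_op_invariant[OF h' a] by simp
  qed
qed

lemma integrable_law: "0 \<le> t \<Longrightarrow> f \<in> bdd_measurable \<pi> C \<Longrightarrow> integrable (law t) f"
  using integrable_bdd_measurable[OF prob_space_law] by fastforce

text \<open>
  The density of the law is only integrable while \<open>pre_\<Gamma> f h\<close> converges only in \<open>L\<^sup>1(\<pi>)\<close>, so the limit
  cannot be taken under the integral. Since \<open>pre_\<Gamma> f h \<ge> 0\<close>, truncation still gives a lower bound,
  which is the direction that is needed.
\<close>

lemma law_pre_\<Gamma>_lower_bound:
  assumes A: "f \<in> \<A>" and b: "f \<in> bdd_measurable \<pi> C" and u: "0 < u" and \<kappa>: "0 \<le> \<kappa>"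
    and less: "ennreal \<kappa> < (\<integral>\<^sup>+x. ennreal (\<Gamma> f x) \<partial>law u)"
  shows "\<forall>\<^sub>F h in at_right 0. 2 * \<kappa> \<le> (\<integral>x. pre_\<Gamma> f h x \<partial>law (u - h))"
proof -
  interpret lu: prob_space "law u" using prob_space_law u by simp
  have \<Gamma>m [measurable]: "\<Gamma> f \<in> borel_measurable \<pi>" using \<Gamma>_integrable[OF A b] by simp
  \<comment> \<open>\<open>ennreal\<close> sends negative reals to 0, so the given integral sees
    only the positive part of \<open>\<Gamma> f\<close>. The bounded truncations
    \<open>\<phi>n\<close> are what can be transported between laws.\<close>
  define \<phi> where "\<phi> x = max 0 (2 * \<Gamma> f x)" for x
  define \<phi>n where "\<phi>n n x = min (real n) (\<phi> x)" for n x
  have \<phi>m [measurable]: "\<phi> \<in> borel_measurable \<pi>" unfolding \<phi>_def by measurable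
  have \<phi>nb: "\<phi>n n \<in> bdd_measurable \<pi> (real n)" for n
    unfolding bdd_measurable_def \<phi>n_def by (auto simp: \<phi>_def)
  have \<phi>n0: "0 \<le> \<phi>n n x" for n x by (simp add: \<phi>n_def \<phi>_def)
  have "ennreal (2 * \<kappa>) < (\<integral>\<^sup>+x. ennreal (\<phi> x) \<partial>law u)"
  proof -
    have "ennreal (2 * \<kappa>) = 2 * ennreal \<kappa>" using \<kappa> by (simp add: ennreal_mult')
    also have "\<dots> < 2 * (\<integral>\<^sup>+x. ennreal (\<Gamma> f x) \<partial>law u)"
      using less by (simp add: ennreal_mult_strict_left_mono)
    also have "\<dots> = (\<integral>\<^sup>+x. 2 * ennreal (\<Gamma> f x) \<partial>law u)" by (simp add: nn_integral_cmult)
    also have "\<dots> = (\<integral>\<^sup>+x. ennreal (\<phi> x) \<partial>law u)"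
      by (intro nn_integral_cong) (simp add: \<phi>_def ennreal_mult' max_def ennreal_neg flip: ennreal_numeral)
    finally show ?thesis .
  qed
  also have "(\<integral>\<^sup>+x. ennreal (\<phi> x) \<partial>law u) = (\<integral>\<^sup>+x. (SUP n. ennreal (\<phi>n n x)) \<partial>law u)"
  proof (intro nn_integral_cong antisym)
    fix x
    show "ennreal (\<phi> x) \<le> (SUP n. ennreal (\<phi>n n x))"
      using real_nat_ceiling_ge[of "\<phi> x"] by (intro SUP_upper2[of "nat \<lceil>\<phi> x\<rceil>"]) (auto simp: \<phi>n_def)
    show "(SUP n. ennreal (\<phi>n n x)) \<le> ennreal (\<phi> x)"
      by (intro SUP_least ennreal_leI) (simp add: \<phi>n_def)
  qed
  also have "\<dots> = (SUP n. (\<integral>\<^sup>+x. ennreal (\<phi>n n x) \<partial>law u))"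
    by (intro nn_integral_monotone_convergence_SUP) (auto simp: incseq_def le_fun_def \<phi>n_def intro!: ennreal_leI)
  finally obtain n where n: "ennreal (2 * \<kappa>) < (\<integral>\<^sup>+x. ennreal (\<phi>n n x) \<partial>law u)"
    by (auto simp: less_SUP_iff)
  have "(\<integral>\<^sup>+x. ennreal (\<phi>n n x) \<partial>law u) = ennreal (\<integral>x. \<phi>n n x \<partial>law u)"
    using integrable_law[OF less_imp_le[OF u] \<phi>nb] \<phi>n0 by (intro nn_integral_eq_integral) auto
  with n have less': "2 * \<kappa> < (\<integral>x. \<phi>n n x \<partial>law u)"
    using \<kappa> by (simp add: ennreal_less_iff)
  \<comment> \<open>A quarter of the gap: two comparisons follow, and each loses at most
    \<open>e\<close> under \<open>\<pi>\<close> and \<open>e\<close> from the truncated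
    density.\<close>
  define e where "e = ((\<integral>x. \<phi>n n x \<partial>law u) - 2 * \<kappa>) / 4"
  have e: "0 < e" using less' by (simp add: e_def)
  obtain K where K0: "0 \<le> K" and K: "\<And>h a. 0 \<le> h \<Longrightarrow> h \<le> u / 2 \<Longrightarrow> a \<in> bdd_measurable \<pi> (real n) \<Longrightarrow>
        (\<And>x. x \<in> space \<pi> \<Longrightarrow> 0 \<le> a x) \<Longrightarrow> (\<integral>x. a x \<partial>law (u - h)) \<le> K * (\<integral>x. a x \<partial>\<pi>) + e"
    using law_uniformly_integrable[OF u e, of "real n"] by auto
  have "((\<lambda>h. K * (\<integral>x. \<bar>semigroup_op P h (\<phi>n n) x - \<phi>n n x\<bar> \<partial>\<pi>)) \<longlongrightarrow> K * 0) (at_right 0)"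
    by (intro tendsto_intros semigroup_op_L1_continuous[OF \<phi>nb])
  then have e1: "\<forall>\<^sub>F h in at_right 0. K * (\<integral>x. \<bar>semigroup_op P h (\<phi>n n) x - \<phi>n n x\<bar> \<partial>\<pi>) < e"
    using e by (intro order_tendstoD) auto
  have "((\<lambda>h. K * (\<integral>x. \<bar>pre_\<Gamma> f h x - 2 * \<Gamma> f x\<bar> \<partial>\<pi>)) \<longlongrightarrow> K * 0) (at_right 0)"
    by (intro tendsto_intros pre_\<Gamma>_tendsto[OF A b])
  then have e2: "\<forall>\<^sub>F h in at_right 0. K * (\<integral>x. \<bar>pre_\<Gamma> f h x - 2 * \<Gamma> f x\<bar> \<partial>\<pi>) < e"
    using e by (intro order_tendstoD) auto
  have "\<forall>\<^sub>F h in at_right (0::real). 0 < h \<and> h \<le> u / 2"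
    using u by (auto intro!: eventually_at_rightI[of 0 "u / 2"])
  with e1 e2 show ?thesis
  proof eventually_elim
    case (elim h)
    then have h: "0 < h" "0 \<le> h" "h \<le> u / 2" "0 \<le> u - h" using u by auto
    interpret l: prob_space "law (u - h)" using prob_space_law h by simp
    note Pb = semigroup_op_bdd_measurable[OF h(2) \<phi>nb, of n]
    note pb = pre_\<Gamma>_bdd_measurable[OF h(1) b]
    note [measurable] = bdd_measurable_measurable[OF Pb] bdd_measurable_measurable[OF \<phi>nb]
      bdd_measurable_measurable[OF pb]
    have P0: "0 \<le> semigroup_op P h (\<phi>n n) x" for x
      unfolding semigroup_op_def using \<phi>n0 by (intro Bochner_Integration.integral_nonneg) auto
    let ?d = "\<lambda>x. \<bar>semigroup_op P h (\<phi>n n) x - \<phi>n n x\<bar>"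
    \<comment> \<open>The a priori bound on \<open>pre_\<Gamma> f h\<close> blows up as
      \<open>h\<close> tends to 0. Cutting at \<open>n\<close> restores a bound uniform in
      \<open>h\<close>, as the choice of \<open>K\<close> demands, and only lowers the
      function.\<close>
    let ?q = "\<lambda>x. min (real n) (pre_\<Gamma> f h x)"
    let ?r = "\<lambda>x. \<bar>?q x - \<phi>n n x\<bar>"
    have d: "?d \<in> bdd_measurable \<pi> (real n)"
    proof -
      have "?d x \<le> real n" if "x \<in> space \<pi>" for x
        using bdd_measurable_bound[OF Pb that] bdd_measurable_bound[OF \<phi>nb that, of n] P0[of x] \<phi>n0[of n x]
        by linarith
      then show ?thesis by (auto simp: bdd_measurable_def)
    qed
    have q: "?q \<in> bdd_measurable \<pi> (real n)"
      using pre_\<Gamma>_nonneg[OF h(1) b] by (auto simp: bdd_measurable_def)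
    have r: "?r \<in> bdd_measurable \<pi> (real n)"
    proof -
      have "?r x \<le> real n" if "x \<in> space \<pi>" for x
        using bdd_measurable_bound[OF q that] bdd_measurable_bound[OF \<phi>nb that, of n] 
          pre_\<Gamma>_nonneg[OF h(1) b that] \<phi>n0[of n x]
        by linarith
      then show ?thesis by (auto simp: bdd_measurable_def)
    qed
    note i = integrable_law[OF h(4) Pb] integrable_law[OF h(4) \<phi>nb, of n] integrable_law[OF h(4) pb]
      integrable_law[OF h(4) d] integrable_law[OF h(4) q] integrable_law[OF h(4) r]
    have "(\<integral>x. \<phi>n n x \<partial>law u) = (\<integral>x. semigroup_op P h (\<phi>n n) x \<partial>law (u - h))"
      using integral_law_add[OF h(4,2) \<phi>nb, of n] by simp
    also have "\<dots> \<le> (\<integral>x. \<phi>n n x + ?d x \<partial>law (u - h))"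
      using i by (intro integral_mono) auto
    also have "\<dots> = (\<integral>x. \<phi>n n x \<partial>law (u - h)) + (\<integral>x. ?d x \<partial>law (u - h))"
      using i by (intro Bochner_Integration.integral_add)
    also have "(\<integral>x. ?d x \<partial>law (u - h)) \<le> K * (\<integral>x. ?d x \<partial>\<pi>) + e"
      by (intro K h d) auto
    also have "(\<integral>x. \<phi>n n x \<partial>law (u - h)) \<le> (\<integral>x. pre_\<Gamma> f h x + ?r x \<partial>law (u - h))"
      using i by (intro integral_mono) auto
    also have "\<dots> = (\<integral>x. pre_\<Gamma> f h x \<partial>law (u - h)) + (\<integral>x. ?r x \<partial>law (u - h))"
      using i by (intro Bochner_Integration.integral_add)
    also have "(\<integral>x. ?r x \<partial>law (u - h)) \<le> K * (\<integral>x. ?r x \<partial>\<pi>) + e"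
      by (intro K h r) auto
    also have "(\<integral>x. ?r x \<partial>\<pi>) \<le> (\<integral>x. \<bar>pre_\<Gamma> f h x - 2 * \<Gamma> f x\<bar> \<partial>\<pi>)"
    proof (rule integral_mono)
      show "integrable \<pi> (\<lambda>x. \<bar>pre_\<Gamma> f h x - 2 * \<Gamma> f x\<bar>)"
        using \<Gamma>_integrable[OF A b] integrable_bdd[OF pb] by simp
      fix x assume "x \<in> space \<pi>"
      \<comment> \<open>Both sides of the difference are clamped to \<open>[0, n]\<close>, and
        clamping is 1-Lipschitz; for \<open>pre_\<Gamma>\<close> the lower clamp is
        inactive.\<close>
      then show "?r x \<le> \<bar>pre_\<Gamma> f h x - 2 * \<Gamma> f x\<bar>"
        using pre_\<Gamma>_nonneg[OF h(1) b, of x] unfolding \<phi>n_def \<phi>_def by linarith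
    qed (rule integrable_bdd[OF r])
    finally have "(\<integral>x. \<phi>n n x \<partial>law u) \<le> (\<integral>x. pre_\<Gamma> f h x \<partial>law (u - h))
        + (K * (\<integral>x. \<bar>pre_\<Gamma> f h x - 2 * \<Gamma> f x\<bar> \<partial>\<pi>) + e) + (K * (\<integral>x. ?d x \<partial>\<pi>) + e)"
      using K0 by (simp add: mult_left_mono)
    then show ?case using elim by (simp add: e_def field_simps)
  qed
qed

section \<open>Decay of the variance for observables in the algebra\<close>

abbreviation law_variance :: "real \<Rightarrow> ('a \<Rightarrow> real) \<Rightarrow> real" where
  "law_variance t f \<equiv> prob_space.variance (law t) f"

abbreviation \<gamma> :: ennreal where "\<gamma> \<equiv> local_poincare_const \<Omega> X \<pi> P \<A>"

text \<open>A real \<open>c\<close> strictly below the supremum lies below some admissible constant,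
  whether or not the supremum is attained or finite.\<close>

lemma local_poincare:
  assumes "0 \<le> c" "ennreal c < \<gamma>" "0 < u" "f \<in> \<A>"
  shows "ennreal (c * law_variance u f) \<le> (\<integral>\<^sup>+x. ennreal (\<Gamma> f x) \<partial>law u)"
proof -
  interpret lu: prob_space "law u" using prob_space_law assms(3) by simp
  have "ennreal c < poincare_const \<pi> P \<A> (law u)"
    using assms(2,3) unfolding local_poincare_const_def
    by (rule_tac order.strict_trans2[OF _ INF_lower]) auto
  then obtain c' where c': "0 \<le> c'" "ennreal c < ennreal c'"
    "ennreal (c' * law_variance u f) \<le> (\<integral>\<^sup>+x. ennreal (\<Gamma> f x) \<partial>law u)"
    using assms(4) unfolding poincare_const_def less_Sup_iff by blast
  then have "c \<le> c'" using assms(1) by (simp add: ennreal_less_iff)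
  then have "c * law_variance u f \<le> c' * law_variance u f"
    by (intro mult_right_mono lu.variance_positive)
  then show ?thesis using c'(3) by (meson ennreal_leI order_trans)
qed

text \<open>The first integral equals that of \<open>P\<^sub>h(g\<^sup>2)\<close> under
  \<open>law v\<close>. The identity is exact for each \<open>h\<close>, so no limit enters until a
  Dini bound is taken.\<close>

lemma integral_square_increment:
  assumes g: "g \<in> bdd_measurable \<pi> C" and h: "0 < h" and v: "0 \<le> v"
  shows "(\<integral>x. (g x)\<^sup>2 \<partial>law (v + h)) - (\<integral>x. (semigroup_op P h g x)\<^sup>2 \<partial>law v)
    = h * (\<integral>x. pre_\<Gamma> g h x \<partial>law v)"
proof -
  have h': "0 \<le> h" using h by simp
  note g2 = bdd_measurable_power2[OF g]
  have "(\<integral>x. (g x)\<^sup>2 \<partial>law (v + h)) = (\<integral>x. semigroup_op P h (\<lambda>y. (g y)\<^sup>2) x \<partial>law v)"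
    using integral_law_add[OF v h' g2] .
  moreover have "integrable (law v) (semigroup_op P h (\<lambda>y. (g y)\<^sup>2))"
    "integrable (law v) (\<lambda>x. (semigroup_op P h g x)\<^sup>2)"
    using integrable_law[OF v] semigroup_op_bdd_measurable[OF h' g2]
      bdd_measurable_power2[OF semigroup_op_bdd_measurable[OF h' g]] by blast+
  ultimately show ?thesis using h by (simp add: pre_\<Gamma>_def[abs_def])
qed

text \<open>The case \<open>v = 0\<close> is included although \<open>law 0\<close> may be singular
  to \<open>\<pi>\<close>: the Poincare inequality and the lower bound are applied only at
  \<open>v + s\<close> with \<open>s > 0\<close>.\<close>

lemma variance_decay_algebra:
  assumes c: "0 \<le> c" "ennreal c < \<gamma>" and v: "0 \<le> v" and t: "0 \<le> t"
    and A: "f \<in> \<A>" and b: "f \<in> bdd_measurable \<pi> C"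
  shows "law_variance v (semigroup_op P t f) \<le> exp (- (2 * c * t)) * law_variance (v + t) f"
proof -
  define g where "g s = semigroup_op P (t - s) f" for s
  define \<psi> where "\<psi> s = law_variance (v + s) (g s)" for s
  have gA: "g s \<in> \<A>" and gb: "g s \<in> bdd_measurable \<pi> C" if "s \<le> t" for s
    using algebra_stable[OF _ A] semigroup_op_bdd_measurable[OF _ b] that by (auto simp: g_def)
  have \<psi>: "\<psi> s = (\<integral>x. (g s x)\<^sup>2 \<partial>law (v + s)) - (\<integral>x. f x \<partial>law (v + t))\<^sup>2" if "0 \<le> s" "s \<le> t" for s
  proof -
    interpret l: prob_space "law (v + s)" using prob_space_law v that by simp
    have "(\<integral>x. g s x \<partial>law (v + s)) = (\<integral>x. f x \<partial>law (v + t))"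
      using integral_law_add[of "v + s" "t - s" f C] b v that by (simp add: g_def)
    then show ?thesis
      unfolding \<psi>_def using v that
      by (subst l.variance_eq)
         (auto intro!: integrable_law[OF _ gb] integrable_law[OF _ bdd_measurable_power2[OF gb]])
  qed
  have inc: "\<psi> s - \<psi> (s - h) = h * (\<integral>x. pre_\<Gamma> (g s) h x \<partial>law (v + s - h))"
    if "0 < h" "h \<le> s" "s \<le> t" for s h
  proof -
    have "g (s - h) x = semigroup_op P h (g s) x" if "x \<in> space \<pi>" for x
      using semigroup_op_add[of h "t - s" f C x] b that \<open>0 < h\<close> \<open>s \<le> t\<close> by (simp add: g_def algebra_simps)
    then have "(\<integral>x. (g (s - h) x)\<^sup>2 \<partial>law (v + s - h)) = (\<integral>x. (semigroup_op P h (g s) x)\<^sup>2 \<partial>law (v + s - h))"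
      by (intro Bochner_Integration.integral_cong) auto
    then show ?thesis
      using integral_square_increment[OF gb[OF that(3)] that(1), of "v + s - h"] v that
      by (simp add: \<psi> add_diff_eq)
  qed
  have "\<psi> 0 \<le> exp (- (2 * c * t)) * \<psi> t"
  proof (rule left_Dini_growth)
    show "0 \<le> \<psi> s" if "0 \<le> s" for s
      using prob_space.variance_positive[OF prob_space_law] v that by (simp add: \<psi>_def)
    show "\<psi> r \<le> \<psi> s" if "0 \<le> r" "r \<le> s" "s \<le> t" for r s
    proof (cases "r = s")
      case False
      have "0 \<le> (\<integral>x. pre_\<Gamma> (g s) (s - r) x \<partial>law (v + r))"
        using that False pre_\<Gamma>_nonneg[OF _ gb] by (intro integral_nonneg_AE AE_I2) auto
      then have "0 \<le> (s - r) * (\<integral>x. pre_\<Gamma> (g s) (s - r) x \<partial>law (v + r))"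
        using that by simp
      then show ?thesis using inc[of "s - r" s] that False by simp
    qed simp
    show "\<forall>\<^sub>F h in at_right 0. h * (2 * c * \<psi> s - e) \<le> \<psi> s - \<psi> (s - h)"
      if s: "0 < s" "s \<le> t" and e: "0 < e" for s e
    proof -
      have hs: "\<forall>\<^sub>F h in at_right (0::real). 0 < h \<and> h \<le> s"
        using s by (auto intro!: eventually_at_rightI[of 0 s])
      have "\<forall>\<^sub>F h in at_right 0. 2 * c * \<psi> s - e \<le> (\<integral>x. pre_\<Gamma> (g s) h x \<partial>law (v + s - h))"
      \<comment> \<open>The lower bound wants a nonnegative level strictly below the energy; half of
        \<open>2 * c * \<psi> s - e\<close> misses \<open>c * \<psi> s\<close> by
        \<open>e / 2\<close>. For a negative level, positivity of \<open>pre_\<Gamma>\<close>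
        suffices.\<close>
      proof (cases "2 * c * \<psi> s - e \<ge> 0")
        case True
        have "ennreal ((2 * c * \<psi> s - e) / 2) < ennreal (c * \<psi> s)"
          using True e by (simp add: ennreal_less_iff)
        also have "\<dots> \<le> (\<integral>\<^sup>+x. ennreal (\<Gamma> (g s) x) \<partial>law (v + s))"
          unfolding \<psi>_def using local_poincare[OF c, of "v + s"] v s gA by simp
        finally have "\<forall>\<^sub>F h in at_right 0. 2 * ((2 * c * \<psi> s - e) / 2)
            \<le> (\<integral>x. pre_\<Gamma> (g s) h x \<partial>law (v + s - h))"
          using True v s by (intro law_pre_\<Gamma>_lower_bound[OF gA gb]) auto
        moreover have "2 * ((2 * c * \<psi> s - e) / 2) = 2 * c * \<psi> s - e" by simp
        ultimately show ?thesis by (simp only:)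
      next
        case False
        show ?thesis
          using hs
        proof eventually_elim
          case (elim h)
          have "0 \<le> (\<integral>x. pre_\<Gamma> (g s) h x \<partial>law (v + s - h))"
            using elim s pre_\<Gamma>_nonneg[OF _ gb] by (intro integral_nonneg_AE AE_I2) auto
          then show ?case using False by simp
        qed
      qed
      with hs show ?thesis
        by eventually_elim (simp add: inc s)
    qed
  qed (use c t in auto)
  moreover have "law_variance (v + t) (g t) = law_variance (v + t) f"
  proof -
    have "g t x = f x" if "x \<in> space \<pi>" for x
      using bdd_measurable_measurable[OF b] that
      by (simp add: g_def semigroup_op_def kernel_0 integral_return)
    then have "(\<integral>x. F (g t x) \<partial>law (v + t)) = (\<integral>x. F (f x) \<partial>law (v + t))" for F :: "real \<Rightarrow> real"
      by (intro Bochner_Integration.integral_cong) auto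
    from this[of "\<lambda>y. (y - m)\<^sup>2" for m] this[of "\<lambda>y. y"] show ?thesis by simp
  qed
  ultimately show ?thesis by (simp add: \<psi>_def g_def)
qed

end

section \<open>From the algebra to indicators\<close>

lemma real_polynomial_function_real_induct [consumes 1, case_names id const add mult]:
  fixes p :: "real \<Rightarrow> real"
  assumes "real_polynomial_function p"
    and id: "Q (\<lambda>x. x)" and const: "\<And>c. Q (\<lambda>x. c)"
    and add: "\<And>f g. Q f \<Longrightarrow> Q g \<Longrightarrow> Q (\<lambda>x. f x + g x)"
    and mult: "\<And>f g. Q f \<Longrightarrow> Q g \<Longrightarrow> Q (\<lambda>x. f x * g x)"
  shows "Q p"
  using assms(1)
proof induction
  case (linear f)
  then obtain c where "f = (\<lambda>x. x * c)" by (auto simp: real_bounded_linear)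
  then show ?case using mult[OF id const] by simp
qed (use const add mult in auto)

text \<open>Dominated convergence twice: for the means, then for the squared deviations. The means
  inherit the bound \<open>C\<close>, whence the dominating constant
  \<open>(2 * C)\<^sup>2\<close>.\<close>

lemma (in prob_space) variance_tendsto:
  fixes F :: "nat \<Rightarrow> 'a \<Rightarrow> real"
  assumes b: "\<And>n. F n \<in> bdd_measurable M C" and f [measurable]: "f \<in> borel_measurable M"
    and lim: "AE x in M. (\<lambda>n. F n x) \<longlonglongrightarrow> f x"
  shows "(\<lambda>n. variance (F n)) \<longlonglongrightarrow> variance f"
proof -
  note [measurable] = b[THEN bdd_measurable_measurable]
  have E: "(\<lambda>n. expectation (F n)) \<longlonglongrightarrow> expectation f"
    using lim by (intro integral_dominated_convergence[where w="\<lambda>_. C"])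
      (auto intro!: AE_I2 bdd_measurable_bound[OF b])
  have Eb: "\<bar>expectation (F n)\<bar> \<le> C" for n
    using integral_bdd_measurable_le[OF prob_space_axioms refl b] .
  show ?thesis
  proof (rule integral_dominated_convergence[where w="\<lambda>_. (2 * C)\<^sup>2"])
    show "AE x in M. (\<lambda>n. (F n x - expectation (F n))\<^sup>2) \<longlonglongrightarrow> (f x - expectation f)\<^sup>2"
      using lim by eventually_elim (intro tendsto_intros E)
    show "AE x in M. norm ((F n x - expectation (F n))\<^sup>2) \<le> (2 * C)\<^sup>2" for n
    proof (rule AE_I2)
      fix x assume "x \<in> space M"
      then have "\<bar>F n x - expectation (F n)\<bar> \<le> \<bar>2 * C\<bar>"
        using bdd_measurable_bound[OF b, of x n] Eb[of n] by linarith
      then show "norm ((F n x - expectation (F n))\<^sup>2) \<le> (2 * C)\<^sup>2"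
        by (simp add: abs_le_square_iff)
    qed
  qed auto
qed

lemma (in prob_space) variance_indicator_le:
  assumes "B \<in> events" shows "variance (indicator B) \<le> (1 / 4 :: real)"
proof -
  have "(\<lambda>x. (indicator B x :: real)\<^sup>2) = indicator B" by (auto simp: indicator_def)
  then have "variance (indicator B) = prob B - (prob B)\<^sup>2"
    using assms by (subst variance_eq) (auto simp: less_top[symmetric])
  also have "\<dots> \<le> 1 / 4"
    using zero_le_power2[of "prob B - 1 / 2"] by (simp add: power2_diff power2_eq_square algebra_simps)
  finally show ?thesis .
qed

context markov_mixing_process
begin

lemma algebra_polynomial:
  fixes p :: "real \<Rightarrow> real"
  assumes "real_polynomial_function p" "g \<in> \<A>"
  shows "(\<lambda>x. p (g x)) \<in> \<A>"
  using assms(1)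
  by (induction rule: real_polynomial_function_real_induct)
     (use assms(2) algebra_const algebra_add algebra_mult in auto)

text \<open>
  The algebra is not closed under truncation; a polynomial close to \<open>max 0 (min 1 y)\<close> on the range of
  the approximant keeps the bound uniform.
\<close>

lemma algebra_approx_indicator:
  assumes B [measurable]: "B \<in> sets \<pi>" and e: "0 < e"
  obtains f where "f \<in> \<A>" "f \<in> bdd_measurable \<pi> 2" "(\<integral>x. \<bar>f x - indicator B x\<bar> \<partial>\<pi>) < e"
proof -
  have iB: "indicator B \<in> bdd_measurable \<pi> 1"
    by (auto simp: bdd_measurable_def indicator_def)
  obtain g D where g: "g \<in> \<A>" "g \<in> bdd_measurable \<pi> D" and gB: "(\<integral>x. \<bar>indicator B x - g x\<bar> \<partial>\<pi>) < e / 2"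
    using algebra_L1_dense[OF iB, of "e / 2"] e by auto
  have "continuous_on {-D..D} (\<lambda>y::real. max 0 (min 1 y))"
    by (intro continuous_intros)
  \<comment> \<open>The tolerance 1 puts \<open>p\<close> within distance 1 of
    \<open>[0, 1]\<close>, which yields the fixed bound 2; the tolerance \<open>e / 2\<close> is one
    half of the error in \<open>L1(\<pi>)\<close>.\<close>
  then obtain p where p: "real_polynomial_function p"
      "\<And>y. y \<in> {-D..D} \<Longrightarrow> \<bar>max 0 (min 1 y) - p y\<bar> < min 1 (e / 2)"
    using Stone_Weierstrass_real_polynomial_function[of "{-D..D}" "\<lambda>y::real. max 0 (min 1 y)" "min 1 (e / 2)"] e
    by auto
  define f where "f x = p (g x)" for x
  have fA: "f \<in> \<A>" unfolding f_def using algebra_polynomial[OF p(1) g(1)] .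
  have pf: "\<bar>max 0 (min 1 (g x)) - f x\<bar> < min 1 (e / 2)" if "x \<in> space \<pi>" for x
    using p(2)[of "g x"] bdd_measurable_bound[OF g(2) that] by (auto simp: f_def abs_le_iff)
  have fb: "f \<in> bdd_measurable \<pi> 2"
    using algebra_measurable[OF fA] pf by (fastforce simp: bdd_measurable_def)
  note i = integrable_bdd[OF fb] integrable_bdd[OF iB] integrable_bdd[OF g(2)]
  have "(\<integral>x. \<bar>f x - indicator B x\<bar> \<partial>\<pi>) \<le> (\<integral>x. e / 2 + \<bar>indicator B x - g x\<bar> \<partial>\<pi>)"
  proof (rule integral_mono)
    fix x assume "x \<in> space \<pi>"
    \<comment> \<open>The indicator takes values in \<open>[0, 1]\<close>, so clamping
      \<open>g\<close> to that interval does not move it away from the indicator.\<close>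
    from pf[OF this] show "\<bar>f x - indicator B x\<bar> \<le> e / 2 + \<bar>indicator B x - g x\<bar>"
      by (auto simp: indicator_def max_def min_def abs_if split: if_splits)
  qed (use i in auto)
  also have "\<dots> = e / 2 + (\<integral>x. \<bar>indicator B x - g x\<bar> \<partial>\<pi>)"
    using i by (simp add: \<pi>.prob_space)
  also have "\<dots> < e" using gB by simp
  finally show thesis using that fA fb by blast
qed

text \<open>A subsequence upgrades convergence in \<open>L1(\<pi>)\<close> to convergence almost
  everywhere. That passes to laws by absolute continuity, and the common bound 2 then permits
  dominated convergence.\<close>

lemma algebra_seq_indicator:
  assumes B [measurable]: "B \<in> sets \<pi>"
  obtains F where "\<And>n::nat. F n \<in> \<A>" "\<And>n. F n \<in> bdd_measurable \<pi> 2"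
    "AE x in \<pi>. (\<lambda>n. F n x) \<longlonglongrightarrow> indicator B x"
proof -
  have "\<forall>n::nat. \<exists>f. f \<in> \<A> \<and> f \<in> bdd_measurable \<pi> 2 \<and> (\<integral>x. \<bar>f x - indicator B x\<bar> \<partial>\<pi>) < inverse (real (Suc n))"
    using algebra_approx_indicator[OF B, of "inverse (real (Suc n))" for n]
    by (metis inverse_positive_iff_positive of_nat_0_less_iff zero_less_Suc)
  then obtain F where F: "\<And>n. F n \<in> \<A>" "\<And>n. F n \<in> bdd_measurable \<pi> 2"
    "\<And>n. (\<integral>x. \<bar>F n x - indicator B x\<bar> \<partial>\<pi>) < inverse (real (Suc n))"
    by metis
  have i: "integrable \<pi> (\<lambda>x. F n x - indicator B x)" for n
    using integrable_bdd[OF F(2)] by (simp add: less_top[symmetric])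
  have "(\<lambda>n. \<integral>x. norm (F n x - indicator B x) \<partial>\<pi>) \<longlonglongrightarrow> 0"
    by (rule tendsto_sandwich[OF _ _ tendsto_const LIMSEQ_inverse_real_of_nat])
       (use F(3) in \<open>auto intro!: always_eventually less_imp_le\<close>)
  from tendsto_L1_AE_subseq[OF i this]
  obtain r where "AE x in \<pi>. (\<lambda>n. F (r n) x - indicator B x) \<longlonglongrightarrow> 0" by blast
  then have "AE x in \<pi>. (\<lambda>n. F (r n) x) \<longlonglongrightarrow> indicator B x"
    by eventually_elim (simp add: LIM_zero_iff)
  then show thesis using that[of "\<lambda>n. F (r n)"] F by blast
qed

text \<open>With \<open>t > 0\<close> the law at \<open>v + t\<close> is absolutely continuous even
  if \<open>v = 0\<close>, so the approximation of the indicator is visible there.\<close>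

lemma variance_decay_indicator:
  assumes c: "0 \<le> c" "ennreal c < \<gamma>" and v: "0 \<le> v" and t: "0 < t" and B [measurable]: "B \<in> sets \<pi>"
  shows "law_variance v (semigroup_op P t (indicator B)) \<le> exp (- (2 * c * t)) * law_variance (v + t) (indicator B)"
proof -
  have t': "0 \<le> t" using t by simp
  interpret lv: prob_space "law v" using prob_space_law v .
  interpret lvt: prob_space "law (v + t)" using prob_space_law v t by simp
  have iB: "indicator B \<in> bdd_measurable \<pi> 1"
    by (auto simp: bdd_measurable_def indicator_def)
  obtain F where FA: "\<And>n::nat. F n \<in> \<A>" and Fb: "\<And>n. F n \<in> bdd_measurable \<pi> 2"
    and F: "AE x in \<pi>. (\<lambda>n. F n x) \<longlonglongrightarrow> indicator B x"
    using algebra_seq_indicator[OF B] by blast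
  note [measurable] = Fb[THEN bdd_measurable_measurable]
  have F1: "AE x in law (v + t). (\<lambda>n. F n x) \<longlonglongrightarrow> indicator B x"
    using F absolutely_continuous_AE[OF _ law_ac] v t by (simp add: sets_distr)
  have lb: "bdd_measurable (law u) C = bdd_measurable \<pi> C" for u C
    by (rule bdd_measurable_cong_sets) simp
  have K: "P t \<in> law v \<rightarrow>\<^sub>M subprob_algebra \<pi>"
    using measurable_prob_algebraD[OF kernel[OF t']] by simp
  \<comment> \<open>\<open>law v\<close> itself may be singular. Since \<open>law (v + t)\<close> is
    a mixture of the kernels \<open>P t x\<close>, its null sets are null for \<open>P t x\<close>
    for almost every starting point.\<close>
  have "AE x in law v. AE y in P t x. (\<lambda>n. F n y) \<longlonglongrightarrow> indicator B y"
    using F1 unfolding law_add[OF v t'] by (subst (asm) AE_bind[OF K]) auto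
  then have F2: "AE x in law v. (\<lambda>n. semigroup_op P t (F n) x) \<longlonglongrightarrow> semigroup_op P t (indicator B) x"
    using AE_space
  proof eventually_elim
    case (elim x)
    then have x: "x \<in> space \<pi>" by simp
    note k = kernel_prob_space[OF t' x]
    interpret K: prob_space "P t x" by fact
    have [measurable_cong]: "sets (P t x) = sets \<pi>" by fact
    show ?case
      unfolding semigroup_op_def
      by (rule integral_dominated_convergence[where w="\<lambda>_. 2"])
         (use elim bdd_measurable_bound[OF Fb] sets_eq_imp_space_eq[OF k(2)] in auto)
  qed
  have "(\<lambda>n. law_variance v (semigroup_op P t (F n))) \<longlonglongrightarrow> law_variance v (semigroup_op P t (indicator B))"
    using bdd_measurable_measurable[OF semigroup_op_bdd_measurable[OF t' iB]] F2
    by (intro lv.variance_tendsto[where C=2]) (simp_all add: lb semigroup_op_bdd_measurable[OF t' Fb])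
  moreover have "(\<lambda>n. exp (- (2 * c * t)) * law_variance (v + t) (F n))
      \<longlonglongrightarrow> exp (- (2 * c * t)) * law_variance (v + t) (indicator B)"
    using F1 by (intro tendsto_mult_left lvt.variance_tendsto[where C=2]) (simp_all add: lb Fb)
  ultimately show ?thesis
    by (rule LIMSEQ_le) (use variance_decay_algebra[OF c v t' FA Fb] in blast)
qed

end

section \<open>Total variation and mixing times\<close>

text \<open>The hypothesis on subsets of \<open>Y\<close> says that the two measures restricted to
  \<open>Y\<close> are ordered, and integrals of nonnegative functions are monotone in the
  measure.\<close>

lemma integral_indicator_mono_measure:
  fixes a :: "'a \<Rightarrow> real"
  assumes s: "sets N = sets M" and Y [measurable]: "Y \<in> sets M"
    and le: "\<And>X. X \<in> sets M \<Longrightarrow> X \<subseteq> Y \<Longrightarrow> emeasure N X \<le> emeasure M X"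
    and i: "integrable M a" "integrable N a" and nn: "\<And>x. 0 \<le> a x"
  shows "(\<integral>x. indicator Y x * a x \<partial>N) \<le> (\<integral>x. indicator Y x * a x \<partial>M)"
proof -
  have YN [measurable]: "Y \<in> sets N" using s Y by simp
  have am: "a \<in> borel_measurable M" "a \<in> borel_measurable N" using i by auto
  have iM: "integrable M (\<lambda>x. indicator Y x * a x)" "integrable N (\<lambda>x. indicator Y x * a x)"
    using i integrable_mult_indicator[OF Y i(1)] integrable_mult_indicator[OF YN i(2)] by auto
  have d: "density N (indicator Y) \<le> density M (indicator Y)"
  proof -
    have "emeasure (density N (indicator Y)) X \<le> emeasure (density M (indicator Y)) X" for X
    proof (cases "X \<in> sets M")
      case True
      then show ?thesis
        using le[of "Y \<inter> X"] s by (simp add: emeasure_density flip: indicator_inter_arith)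
    next
      case False
      then show ?thesis using s by (simp add: emeasure_notin_sets)
    qed
    then show ?thesis
      by (simp add: le_measure s le_fun_def)
  qed
  have eq: "(\<integral>\<^sup>+x. ennreal (indicator Y x * a x) \<partial>Q) = (\<integral>\<^sup>+x. ennreal (a x) \<partial>density Q (indicator Y))"
    if "a \<in> borel_measurable Q" "Y \<in> sets Q" for Q
    using that nn by (subst nn_integral_density) (auto intro!: nn_integral_cong simp: indicator_def)
  have "(\<integral>\<^sup>+x. ennreal (indicator Y x * a x) \<partial>N) \<le> (\<integral>\<^sup>+x. ennreal (indicator Y x * a x) \<partial>M)"
    unfolding eq[OF am(1) Y] eq[OF am(2) YN] using d s by (intro nn_integral_mono_measure) auto
  moreover have "(\<integral>\<^sup>+x. ennreal (indicator Y x * a x) \<partial>M) < \<infinity>"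
    using integrableD(2)[OF iM(1)] nn by (simp add: less_top)
  ultimately show ?thesis
    using nn iM by (simp add: nn_integral_eq_integral)
qed

text \<open>Integrate \<open>(m - n)\<^sup>2 \<le> 2 * (g x - m)\<^sup>2 + 2 * (g x -
  n)\<^sup>2\<close> against the minimum of the two measures. By a Hahn decomposition this minimum
  is \<open>N\<close> on \<open>Y\<close> and \<open>M\<close> on the complement
  \<open>Z\<close>.\<close>

lemma overlap_mean_difference:
  assumes "prob_space M" "prob_space N" and s: "sets N = sets M"
    and \<delta>: "\<And>Y. Y \<in> sets M \<Longrightarrow> \<delta> \<le> 1 - (measure M Y - measure N Y)"
    and g: "g \<in> bdd_measurable M C"
  shows "\<delta> * ((\<integral>x. g x \<partial>M) - (\<integral>x. g x \<partial>N))\<^sup>2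
    \<le> 2 * (prob_space.variance M g + prob_space.variance N g)"
proof -
  interpret M: prob_space M by fact
  interpret N: prob_space N by fact
  define m n where "m = (\<integral>x. g x \<partial>M)" and "n = (\<integral>x. g x \<partial>N)"
  obtain Y where Y [measurable]: "Y \<in> sets M"
    and le: "\<And>X. X \<in> sets M \<Longrightarrow> X \<subseteq> Y \<Longrightarrow> emeasure N X \<le> emeasure M X"
      "\<And>X. X \<in> sets M \<Longrightarrow> X \<inter> Y = {} \<Longrightarrow> emeasure M X \<le> emeasure N X"
    using finite_unsigned_Hahn_decomposition[OF M.finite_measure_axioms N.finite_measure_axioms s] by blast
  define Z where "Z = space M - Y"
  have Z [measurable]: "Z \<in> sets M" unfolding Z_def by measurable
  have YN: "Y \<in> sets N" "Z \<in> sets N" using s Y Z by auto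
  have gN: "g \<in> bdd_measurable N C" using g bdd_measurable_cong_sets[OF s] by simp
  have isq: "integrable M (\<lambda>x. (g x - k)\<^sup>2)" "integrable N (\<lambda>x. (g x - k)\<^sup>2)" for k
    using M.integrable_square_add(2)[of g "\<lambda>_. k"] N.integrable_square_add(2)[of g "\<lambda>_. k"]
      bdd_measurable_measurable[OF g] bdd_measurable_measurable[OF gN]
      integrable_bdd_measurable[OF M.prob_space_axioms refl bdd_measurable_power2[OF g]]
      integrable_bdd_measurable[OF N.prob_space_axioms refl bdd_measurable_power2[OF gN]]
    by simp_all
  have isqi: "integrable M (\<lambda>x. indicator A x * (g x - k)\<^sup>2)" "integrable N (\<lambda>x. indicator A x * (g x - k)\<^sup>2)"
    if "A \<in> sets M" for k A
    using integrable_mult_indicator[OF that isq(1)] integrable_mult_indicator[OF _ isq(2), of A k] that s by auto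
  have split: "(\<integral>x. indicator Y x * (g x - k)\<^sup>2 \<partial>Q) + (\<integral>x. indicator Z x * (g x - k)\<^sup>2 \<partial>Q) = (\<integral>x. (g x - k)\<^sup>2 \<partial>Q)"
    if "Q = M \<or> Q = N" for Q k
  proof -
    have "space Q = space M" using that s sets_eq_imp_space_eq by blast
    have "(\<integral>x. indicator Y x * (g x - k)\<^sup>2 \<partial>Q) + (\<integral>x. indicator Z x * (g x - k)\<^sup>2 \<partial>Q)
        = (\<integral>x. indicator Y x * (g x - k)\<^sup>2 + indicator Z x * (g x - k)\<^sup>2 \<partial>Q)"
      using that isqi[OF Y, of k] isqi[OF Z, of k] by (subst Bochner_Integration.integral_add) auto
    also have "\<dots> = (\<integral>x. (g x - k)\<^sup>2 \<partial>Q)"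
      using \<open>space Q = space M\<close> by (intro Bochner_Integration.integral_cong) (auto simp: Z_def indicator_def)
    finally show ?thesis .
  qed
  have pt: "(m - n)\<^sup>2 \<le> 2 * (g x - m)\<^sup>2 + 2 * (g x - n)\<^sup>2" for x
    using zero_le_power2[of "(g x - m) + (g x - n)"] by (simp add: power2_eq_square algebra_simps)
  have part: "measure Q A * (m - n)\<^sup>2
      \<le> 2 * (\<integral>x. indicator A x * (g x - m)\<^sup>2 \<partial>Q) + 2 * (\<integral>x. indicator A x * (g x - n)\<^sup>2 \<partial>Q)"
    if Q: "Q = M \<or> Q = N" and A: "A \<in> sets M" for Q A
  proof -
    have AQ: "A \<in> sets Q" using Q A s by auto
    have iA: "integrable Q (indicator A :: _ \<Rightarrow> real)"
      using Q A s by (auto simp: less_top[symmetric])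
    have "measure Q A * (m - n)\<^sup>2 = (\<integral>x. indicator A x * (m - n)\<^sup>2 \<partial>Q)"
      using AQ by simp
    also have "\<dots> \<le> (\<integral>x. 2 * (indicator A x * (g x - m)\<^sup>2) + 2 * (indicator A x * (g x - n)\<^sup>2) \<partial>Q)"
    proof (rule integral_mono)
      show "integrable Q (\<lambda>x. indicator A x * (m - n)\<^sup>2)" using iA by simp
      show "integrable Q (\<lambda>x. 2 * (indicator A x * (g x - m)\<^sup>2) + 2 * (indicator A x * (g x - n)\<^sup>2))"
        using Q isqi[OF A] by (intro Bochner_Integration.integrable_add integrable_mult_right) blast+
      show "indicator A x * (m - n)\<^sup>2 \<le> 2 * (indicator A x * (g x - m)\<^sup>2) + 2 * (indicator A x * (g x - n)\<^sup>2)" for x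
        using pt[of x] by (simp add: indicator_def)
    qed
    also have "\<dots> = 2 * (\<integral>x. indicator A x * (g x - m)\<^sup>2 \<partial>Q) + 2 * (\<integral>x. indicator A x * (g x - n)\<^sup>2 \<partial>Q)"
      using Q isqi[OF A] by auto
    finally show ?thesis .
  qed
  have N_le_M: "(\<integral>x. indicator Y x * (g x - k)\<^sup>2 \<partial>N) \<le> (\<integral>x. indicator Y x * (g x - k)\<^sup>2 \<partial>M)" for k
    using le(1) isq by (intro integral_indicator_mono_measure s Y) auto
  have M_le_N: "(\<integral>x. indicator Z x * (g x - k)\<^sup>2 \<partial>M) \<le> (\<integral>x. indicator Z x * (g x - k)\<^sup>2 \<partial>N)" for k
  proof (rule integral_indicator_mono_measure)
    fix X assume "X \<in> sets N" "X \<subseteq> Z"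
    then show "emeasure M X \<le> emeasure N X"
      using le(2)[of X] s by (auto simp: Z_def)
  qed (use isq YN s in auto)
  \<comment> \<open>The right side is the mass of the minimum, equal to
    \<open>1 - (measure M Y - measure N Y)\<close>.\<close>
  have "\<delta> \<le> measure N Y + measure M Z"
    using \<delta>[OF Y] M.prob_compl[OF Y] by (simp add: Z_def)
  then have "\<delta> * (m - n)\<^sup>2 \<le> (measure N Y + measure M Z) * (m - n)\<^sup>2"
    by (rule mult_right_mono) simp
  \<comment> \<open>Deviations from \<open>m\<close> are charged to \<open>M\<close>, those from
    \<open>n\<close> to \<open>N\<close>: on \<open>Y\<close> the former pass from \<open>N\<close>
    to \<open>M\<close>, on \<open>Z\<close> the latter from \<open>M\<close> to \<open>N\<close>.
    Each then adds up to a full variance.\<close>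
  also have "\<dots> \<le> 2 * (\<integral>x. (g x - m)\<^sup>2 \<partial>M) + 2 * (\<integral>x. (g x - n)\<^sup>2 \<partial>N)"
    using part[of N Y] part[of M Z] N_le_M[of m] M_le_N[of n] split[of M m] split[of N n]
    by (simp add: Y Z distrib_right)
  finally show ?thesis by (simp add: m_def n_def)
qed

lemma d_TV_bdd_above:
  assumes "prob_space M" "prob_space N"
  shows "bdd_above ((\<lambda>A. \<bar>measure M A - measure N A\<bar>) ` sets M)"
proof (rule bdd_aboveI2)
  fix A
  show "\<bar>measure M A - measure N A\<bar> \<le> 1"
    using prob_space.prob_le_1[OF assms(1), of A] prob_space.prob_le_1[OF assms(2), of A]
      measure_nonneg[of M A] measure_nonneg[of N A] by linarith
qed

lemma abs_measure_diff_le_d_TV: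
  assumes "prob_space M" "prob_space N" "A \<in> sets M"
  shows "\<bar>measure M A - measure N A\<bar> \<le> d_TV M N"
  unfolding d_TV_def using d_TV_bdd_above[OF assms(1,2)] assms(3) by (intro cSUP_upper2) auto

context markov_mixing_process
begin

lemma d_TV_contraction:
  assumes c: "0 < c" "ennreal c < \<gamma>" and s: "0 \<le> s" and r: "0 < r" and \<epsilon>: "0 < \<epsilon>"
    and tv: "d_TV (law s) \<pi> \<le> 1 - \<epsilon>" and exp: "exp (- (2 * c * r)) \<le> \<epsilon> ^ 3"
  shows "d_TV (law (s + r)) \<pi> \<le> \<epsilon>"
  unfolding d_TV_def
proof (rule cSUP_least)
  fix B assume "B \<in> sets (law (s + r))"
  then have B [measurable]: "B \<in> sets \<pi>" by simp
  have r': "0 \<le> r" using r by simp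
  have iB: "indicator B \<in> bdd_measurable \<pi> 1"
    by (auto simp: bdd_measurable_def indicator_def)
  let ?g = "semigroup_op P r (indicator B)"
  note gb = semigroup_op_bdd_measurable[OF r' iB]
  have mean: "(\<integral>x. ?g x \<partial>law v) = measure (law (v + r)) B" if "0 \<le> v" for v
    using integral_law_add[OF that r' iB] by simp
  have var: "law_variance v ?g \<le> exp (- (2 * c * r)) / 4" if "0 \<le> v" for v
  proof -
    interpret l: prob_space "law (v + r)" using prob_space_law that r by simp
    have "law_variance v ?g \<le> exp (- (2 * c * r)) * law_variance (v + r) (indicator B)"
      using variance_decay_indicator[OF _ c(2) that r B] c(1) by simp
    also have "\<dots> \<le> exp (- (2 * c * r)) * (1 / 4)"
      by (intro mult_left_mono l.variance_indicator_le) auto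
    finally show ?thesis by simp
  qed
  have TVpi: "\<bar>measure (law v) A - measure \<pi> A\<bar> \<le> d_TV (law v) \<pi>" if "0 \<le> v" "A \<in> sets \<pi>" for v A
    using abs_measure_diff_le_d_TV[OF prob_space_law[OF that(1)] \<pi>.prob_space_axioms] that(2) by simp
  \<comment> \<open>The overlap of \<open>law s\<close> with \<open>law u\<close> is at least
    \<open>1 - (1 - \<epsilon>)\<close> minus the distance of \<open>law u\<close> from
    \<open>\<pi>\<close>, which vanishes as \<open>u\<close> grows.\<close>
  have ev: "(\<epsilon> - d_TV (law u) \<pi>) * (measure (law (s + r)) B - measure (law (u + r)) B)\<^sup>2 \<le> \<epsilon> ^ 3"
    if u: "0 \<le> u" for u
  proof -
    have "(\<epsilon> - d_TV (law u) \<pi>) * ((\<integral>x. ?g x \<partial>law s) - (\<integral>x. ?g x \<partial>law u))\<^sup>2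
        \<le> 2 * (law_variance s ?g + law_variance u ?g)"
    proof (rule overlap_mean_difference[OF prob_space_law[OF s] prob_space_law[OF u]])
      show "?g \<in> bdd_measurable (law s) 1"
        using gb bdd_measurable_cong_sets[of "law s" \<pi> 1] by simp
      fix Y assume "Y \<in> sets (law s)"
      then show "\<epsilon> - d_TV (law u) \<pi> \<le> 1 - (measure (law s) Y - measure (law u) Y)"
        using TVpi[OF s, of Y] TVpi[OF u, of Y] tv by simp
    qed simp
    also have "\<dots> \<le> exp (- (2 * c * r))" using var[OF s] var[OF u] by simp
    finally show ?thesis using exp by (simp add: mean s u)
  qed
  have "((\<lambda>u. d_TV (law (u + r)) \<pi>) \<longlongrightarrow> 0) at_top"
    using filterlim_compose[OF law_tendsto filterlim_tendsto_add_at_top[OF tendsto_const[of r] filterlim_ident]]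
    by (simp add: add.commute)
  moreover have "\<forall>\<^sub>F u in at_top. norm (measure (law (u + r)) B - measure \<pi> B) \<le> d_TV (law (u + r)) \<pi>"
    using eventually_ge_at_top[of 0] by eventually_elim (use TVpi B r in auto)
  ultimately have "((\<lambda>u. measure (law (u + r)) B - measure \<pi> B) \<longlongrightarrow> 0) at_top"
    by (rule Lim_null_comparison[rotated])
  then have mB: "((\<lambda>u. measure (law (u + r)) B) \<longlongrightarrow> measure \<pi> B) at_top"
    by (simp add: LIM_zero_iff)
  have "(\<epsilon> - 0) * (measure (law (s + r)) B - measure \<pi> B)\<^sup>2 \<le> \<epsilon> ^ 3"
  proof (rule tendsto_upperbound)
    show "((\<lambda>u. (\<epsilon> - d_TV (law u) \<pi>) * (measure (law (s + r)) B - measure (law (u + r)) B)\<^sup>2)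
        \<longlongrightarrow> (\<epsilon> - 0) * (measure (law (s + r)) B - measure \<pi> B)\<^sup>2) at_top"
      by (intro tendsto_intros law_tendsto mB)
    show "\<forall>\<^sub>F u in at_top. (\<epsilon> - d_TV (law u) \<pi>) * (measure (law (s + r)) B - measure (law (u + r)) B)\<^sup>2 \<le> \<epsilon> ^ 3"
      using eventually_ge_at_top[of 0] by eventually_elim (rule ev)
  qed simp
  then have "\<epsilon> * (measure (law (s + r)) B - measure \<pi> B)\<^sup>2 \<le> \<epsilon> * \<epsilon>\<^sup>2"
    by (simp add: power2_eq_square power3_eq_cube)
  then have "(measure (law (s + r)) B - measure \<pi> B)\<^sup>2 \<le> \<epsilon>\<^sup>2" using \<epsilon> by simp
  then show "\<bar>measure (law (s + r)) B - measure \<pi> B\<bar> \<le> \<epsilon>" using \<epsilon> by (metis abs_le_square_iff abs_of_pos)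
qed (use sets.empty_sets in blast)

text \<open>Every time \<open>s\<close> admissible for \<open>1 - \<epsilon>\<close> makes
  \<open>s + r\<close> admissible for \<open>\<epsilon>\<close>; then take the infimum over
  \<open>s\<close>. With \<open>c\<close> kept as a factor, the degenerate values of
  \<open>\<gamma>\<close> cause no division here.\<close>

lemma t_mix_le:
  assumes c: "0 < c" "ennreal c < \<gamma>" and \<epsilon>: "0 < \<epsilon>" "\<epsilon> < 1"
  shows "c * (t_mix \<Omega> X \<pi> \<epsilon> - t_mix \<Omega> X \<pi> (1 - \<epsilon>)) \<le> 3 / 2 * ln (1 / \<epsilon>)"
proof -
  define r where "r = 3 / (2 * c) * ln (1 / \<epsilon>)"
  have r: "0 < r" using c \<epsilon> by (simp add: r_def)
  have e: "exp (- (2 * c * r)) \<le> \<epsilon> ^ 3"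
  proof -
    have "- (2 * c * r) = 3 * ln \<epsilon>" using c \<epsilon> by (simp add: r_def ln_div)
    then show ?thesis using \<epsilon> by (simp add: exp_of_nat_mult[of 3, simplified])
  qed
  have "t_mix \<Omega> X \<pi> \<epsilon> - r \<le> t_mix \<Omega> X \<pi> (1 - \<epsilon>)"
    unfolding t_mix_def[of _ _ _ "1 - \<epsilon>"]
  proof (rule cInf_greatest)
    show "{t. 0 \<le> t \<and> d_TV (law t) \<pi> \<le> 1 - \<epsilon>} \<noteq> {}" using \<epsilon> by (intro t_mix_set_nonempty) simp
    fix s assume "s \<in> {t. 0 \<le> t \<and> d_TV (law t) \<pi> \<le> 1 - \<epsilon>}"
    then have s: "0 \<le> s" "d_TV (law s) \<pi> \<le> 1 - \<epsilon>" by auto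
    have "t_mix \<Omega> X \<pi> \<epsilon> \<le> s + r"
      unfolding t_mix_def
      using d_TV_contraction[OF c s(1) r \<epsilon>(1) s(2) e] s r
      by (intro cInf_lower) (auto intro: bdd_belowI[of _ 0])
    then show "t_mix \<Omega> X \<pi> \<epsilon> - r \<le> s" by simp
  qed
  then have "c * (t_mix \<Omega> X \<pi> \<epsilon> - t_mix \<Omega> X \<pi> (1 - \<epsilon>)) \<le> c * r"
    using c by (intro mult_left_mono) auto
  also have "c * r = 3 / 2 * ln (1 / \<epsilon>)" using c by (simp add: r_def)
  finally show ?thesis .
qed

lemma t_mix_antimono:
  assumes "0 < \<epsilon>" "\<epsilon> \<le> \<epsilon>'" shows "t_mix \<Omega> X \<pi> \<epsilon>' \<le> t_mix \<Omega> X \<pi> \<epsilon>"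
  unfolding t_mix_def
  using assms by (intro cInf_superset_mono t_mix_set_nonempty) (auto intro: bdd_belowI[of _ 0])

lemma t_mix_nonneg: "0 < \<epsilon> \<Longrightarrow> 0 \<le> t_mix \<Omega> X \<pi> \<epsilon>"
  unfolding t_mix_def using t_mix_set_nonempty by (intro cInf_greatest) auto

end

section \<open>Extended-real arithmetic and cutoff\<close>

lemma ennreal_less_mult_iff:
  assumes "0 \<le> R" "0 \<le> x"
  shows "ennreal R < a * ennreal x \<longleftrightarrow> (\<exists>c>0. ennreal c < a \<and> R < c * x)"
proof
  assume less: "ennreal R < a * ennreal x"
  \<comment> \<open>In \<open>ennreal\<close> the product of infinity and 0 is 0, so the strict
    inequality excludes \<open>x = 0\<close> even for infinite \<open>a\<close>.\<close>
  then have x: "0 < x" using assms by (cases "x = 0") auto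
  show "\<exists>c>0. ennreal c < a \<and> R < c * x"
  proof (cases a)
    case (real g)
    then have "R / x < g"
      using less x assms by (simp add: field_simps ennreal_less_iff flip: ennreal_mult)
    then obtain c where "R / x < c" "c < g" using dense by blast
    moreover from this have "0 < c" using assms x by (meson divide_nonneg_pos order.strict_trans1)
    ultimately show ?thesis using real x by (auto simp: field_simps ennreal_less_iff intro!: exI[of _ c])
  next
    case top
    then show ?thesis using x assms by (intro exI[of _ "R / x + 1"]) (auto simp: field_simps add_nonneg_pos)
  qed
next
  assume "\<exists>c>0. ennreal c < a \<and> R < c * x"
  then obtain c where c: "0 < c" "ennreal c < a" "R < c * x" by blast
  have "ennreal R < ennreal c * ennreal x"
    using c assms by (simp add: ennreal_less_iff flip: ennreal_mult)
  also have "\<dots> \<le> a * ennreal x" using c by (intro mult_right_mono) auto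
  finally show "ennreal R < a * ennreal x" .
qed

text \<open>Restates divergence through real constants \<open>c\<close> strictly below
  \<open>a n\<close>, the form in which the window bound is available.\<close>

lemma ennreal_mult_tendsto_top_iff:
  assumes "\<And>n. 0 \<le> x n"
  shows "(\<lambda>n::nat. a n * ennreal (x n)) \<longlonglongrightarrow> \<infinity> \<longleftrightarrow>
    (\<forall>R\<ge>0. \<forall>\<^sub>F n in sequentially. \<exists>c>0. ennreal c < a n \<and> R < c * x n)"
  unfolding infinity_ennreal_def tendsto_top_iff_ennreal
  using ennreal_less_mult_iff[OF _ assms] by simp

text \<open>Let \<open>c\<close> increase to \<open>a\<close>. For \<open>a = 0\<close> the right
  side is infinite because \<open>K > 0\<close>; for infinite \<open>a\<close> the hypothesis with
  arbitrarily large \<open>c\<close> forces \<open>w \<le> 0\<close>. These are the conventions for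
  \<open>1 / 0\<close> and \<open>1 / \<infinity>\<close>.\<close>

lemma ennreal_le_divide_of_mult_le:
  assumes "0 < K" and le: "\<And>c. 0 < c \<Longrightarrow> ennreal c < a \<Longrightarrow> c * w \<le> 3 / 2 * K"
  shows "ennreal w \<le> 3 / (2 * a) * ennreal K"
proof (cases a)
  case (real g)
  show ?thesis
  proof (cases "g = 0 \<or> w \<le> 0")
    case True
    then show ?thesis
    proof
      assume "g = 0"
      then show ?thesis using real assms(1) by (simp add: ennreal_divide_eq_top_iff ennreal_top_mult)
    qed (simp add: ennreal_neg)
  next
    case False
    then have g: "0 < g" and w: "0 < w" using real by auto
    have "g \<le> 3 / 2 * K / w"
    proof (rule dense_le_bounded[OF g])
      fix c assume "0 < c" "c < g"
      then show "c \<le> 3 / 2 * K / w" using le[of c] w real by (simp add: field_simps ennreal_less_iff)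
    qed
    then have "w \<le> 3 / (2 * g) * K" using w g by (simp add: field_simps)
    then have "ennreal w \<le> ennreal (3 / (2 * g) * K)" by (rule ennreal_leI)
    also have "\<dots> = ennreal (3 / (2 * g)) * ennreal K"
      using assms(1) by (intro ennreal_mult'') simp
    also have "ennreal (3 / (2 * g)) = 3 / (2 * a)"
      using g real by (simp add: ennreal_mult' flip: divide_ennreal)
    finally show ?thesis .
  qed
next
  case top
  have "w \<le> 0"
  proof (rule ccontr)
    assume "\<not> w \<le> 0"
    then show False using le[of "(3 / 2 * K + 1) / w"] top assms(1) by (simp add: field_simps)
  qed
  then show ?thesis by (simp add: ennreal_neg)
qed

text \<open>Only monotonicity and the window bound matter: measured in units of
  \<open>1 / c\<close>, mixing times at any two levels differ by a bounded amount, negligible once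
  one of them is large.\<close>

lemma cutoff_of_window_bound:
  fixes T :: "nat \<Rightarrow> real \<Rightarrow> real" and a :: "nat \<Rightarrow> ennreal" and C :: "real \<Rightarrow> real"
  assumes nonneg: "\<And>n \<epsilon>. 0 < \<epsilon> \<Longrightarrow> 0 \<le> T n \<epsilon>"
    and anti: "\<And>n \<epsilon> \<epsilon>'. 0 < \<epsilon> \<Longrightarrow> \<epsilon> \<le> \<epsilon>' \<Longrightarrow> T n \<epsilon>' \<le> T n \<epsilon>"
    and window: "\<And>n c \<epsilon>. 0 < c \<Longrightarrow> ennreal c < a n \<Longrightarrow> 0 < \<epsilon> \<Longrightarrow> \<epsilon> < 1 \<Longrightarrow>
      c * (T n \<epsilon> - T n (1 - \<epsilon>)) \<le> C \<epsilon>"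
    and C: "\<And>\<epsilon>. 0 < \<epsilon> \<Longrightarrow> \<epsilon> < 1 \<Longrightarrow> 0 \<le> C \<epsilon>"
    and \<epsilon>0: "\<epsilon>0 \<in> {0<..<1}" "(\<lambda>n. a n * ennreal (T n \<epsilon>0)) \<longlonglongrightarrow> \<infinity>"
  shows "\<forall>\<epsilon>\<in>{0<..<1}. (\<lambda>n. a n * ennreal (T n \<epsilon>)) \<longlonglongrightarrow> \<infinity>" (is ?A)
    and "\<forall>\<epsilon>\<in>{0<..<1}. (\<lambda>n. T n (1 - \<epsilon>) / T n \<epsilon>) \<longlonglongrightarrow> 1" (is ?B)
proof -
  have large: "\<forall>\<^sub>F n in sequentially. \<exists>c>0. ennreal c < a n \<and> R < c * T n \<epsilon>"
    if \<epsilon>: "0 < \<epsilon>" "\<epsilon> < 1" and R: "0 \<le> R" for \<epsilon> R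
  proof -
    \<comment> \<open>Small enough that the window from \<open>1 - \<delta>\<close> to
      \<open>\<delta>\<close> brackets both levels: divergence at \<open>\<epsilon>0\<close> gives
      it at \<open>\<delta>\<close>, the window carries it to \<open>1 - \<delta>\<close> at cost
      \<open>C \<delta>\<close>, and monotonicity to \<open>\<epsilon>\<close>.\<close>
    define \<delta> where "\<delta> = min (min \<epsilon>0 (1 - \<epsilon>0)) (min \<epsilon> (1 - \<epsilon>))"
    have \<delta>: "0 < \<delta>" "\<delta> < 1" "\<delta> \<le> \<epsilon>0" "\<epsilon> \<le> 1 - \<delta>" using \<epsilon> \<epsilon>0(1) by (auto simp: \<delta>_def)
    have "\<forall>\<^sub>F n in sequentially. \<exists>c>0. ennreal c < a n \<and> R + C \<delta> < c * T n \<epsilon>0"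
      using \<epsilon>0 C[OF \<delta>(1,2)] R ennreal_mult_tendsto_top_iff[of "\<lambda>n. T n \<epsilon>0" a] nonneg by auto
    then show ?thesis
    proof eventually_elim
      case (elim n)
      then obtain c where c: "0 < c" "ennreal c < a n" "R + C \<delta> < c * T n \<epsilon>0" by blast
      have "c * T n \<epsilon>0 \<le> c * T n \<delta>" using anti[OF \<delta>(1,3)] c by simp
      moreover have "c * T n \<delta> - C \<delta> \<le> c * T n (1 - \<delta>)"
        using window[OF c(1,2) \<delta>(1,2)] by (simp add: algebra_simps)
      moreover have "c * T n (1 - \<delta>) \<le> c * T n \<epsilon>" using anti[OF \<epsilon>(1) \<delta>(4)] c by simp
      ultimately show ?case using c by (intro exI[of _ c]) linarith
    qed
  qed
  then show ?A
    using ennreal_mult_tendsto_top_iff[of "\<lambda>n. T n \<epsilon>" a for \<epsilon>] nonneg by auto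
  have half: "(\<lambda>n. T n (1 - \<epsilon>) / T n \<epsilon>) \<longlonglongrightarrow> 1" if \<epsilon>: "0 < \<epsilon>" "\<epsilon> \<le> 1 / 2" for \<epsilon>
  proof (rule LIMSEQ_I)
    fix \<eta> :: real assume \<eta>: "0 < \<eta>"
    \<comment> \<open>Once \<open>c * T n \<epsilon>\<close> exceeds this level, it is positive and
      the window is less than the fraction \<open>\<eta>\<close> of
      \<open>T n \<epsilon>\<close>.\<close>
    have C0: "0 \<le> C \<epsilon> / \<eta>" using \<epsilon> \<eta> C[of \<epsilon>] by simp
    have \<epsilon>1: "\<epsilon> < 1" using \<epsilon> by simp
    have "\<forall>\<^sub>F n in sequentially. norm (T n (1 - \<epsilon>) / T n \<epsilon> - 1) < \<eta>"
      using large[OF \<epsilon>(1) \<epsilon>1 C0]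
    proof eventually_elim
      case (elim n)
      then obtain c where c: "0 < c" "ennreal c < a n" "C \<epsilon> / \<eta> < c * T n \<epsilon>"
        by blast
      have "0 < c * T n \<epsilon>" using C0 c by linarith
      then have T: "0 < T n \<epsilon>" using c by (simp add: zero_less_mult_iff)
      have "c * (T n \<epsilon> - T n (1 - \<epsilon>)) \<le> C \<epsilon>" using window[OF c(1,2)] \<epsilon> by simp
      also have "C \<epsilon> < c * (\<eta> * T n \<epsilon>)" using c \<eta> by (simp add: field_simps)
      finally have "T n \<epsilon> - T n (1 - \<epsilon>) < \<eta> * T n \<epsilon>" using c by simp
      moreover have "T n (1 - \<epsilon>) \<le> T n \<epsilon>" using \<epsilon> by (intro anti) auto
      moreover have "T n (1 - \<epsilon>) / T n \<epsilon> - 1 = - ((T n \<epsilon> - T n (1 - \<epsilon>)) / T n \<epsilon>)"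
        using T by (simp add: field_simps)
      ultimately show ?case using T by (simp add: field_simps)
    qed
    then show "\<exists>N. \<forall>n\<ge>N. norm (T n (1 - \<epsilon>) / T n \<epsilon> - 1) < \<eta>"
      by (simp add: eventually_sequentially)
  qed
  show ?B
  proof
    fix \<epsilon> :: real assume \<epsilon>: "\<epsilon> \<in> {0<..<1}"
    show "(\<lambda>n. T n (1 - \<epsilon>) / T n \<epsilon>) \<longlonglongrightarrow> 1"
    proof (cases "\<epsilon> \<le> 1 / 2")
      case True
      then show ?thesis using half \<epsilon> by simp
    next
      case False
      \<comment> \<open>Exchanging \<open>\<epsilon>\<close> and \<open>1 - \<epsilon>\<close>
        inverts the ratio, and its limit 1 is nonzero.\<close>
      then have "(\<lambda>n. T n \<epsilon> / T n (1 - \<epsilon>)) \<longlonglongrightarrow> 1"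
        using half[of "1 - \<epsilon>"] \<epsilon> by simp
      from tendsto_inverse[OF this] show ?thesis by simp
    qed
  qed
qed

theorem theorem1:
  shows "(\<forall>(\<Omega> :: 'w measure) (X :: real \<Rightarrow> 'w \<Rightarrow> 'a) (\<pi> :: 'a measure)
            (P :: real \<Rightarrow> 'a \<Rightarrow> 'a measure) (\<A> :: ('a \<Rightarrow> real) set) (\<epsilon> :: real).
          markov_mixing_process \<Omega> X \<pi> P \<A> \<longrightarrow> 0 < \<epsilon> \<longrightarrow> \<epsilon> \<le> 1 / 2 \<longrightarrow>
          ennreal (w_mix \<Omega> X \<pi> \<epsilon>)
            \<le> 3 / (2 * local_poincare_const \<Omega> X \<pi> P \<A>) * ennreal (ln (1 / \<epsilon>)))
    \<and> (\<forall>(\<Omega> :: nat \<Rightarrow> 'w measure) (X :: nat \<Rightarrow> real \<Rightarrow> 'w \<Rightarrow> 'a) (\<pi> :: nat \<Rightarrow> 'a measure)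
            (P :: nat \<Rightarrow> real \<Rightarrow> 'a \<Rightarrow> 'a measure) (\<A> :: nat \<Rightarrow> ('a \<Rightarrow> real) set).
          (\<forall>n. markov_mixing_process (\<Omega> n) (X n) (\<pi> n) (P n) (\<A> n)) \<longrightarrow>
          (\<exists>\<epsilon>\<in>{0<..<1}. (\<lambda>n. local_poincare_const (\<Omega> n) (X n) (\<pi> n) (P n) (\<A> n)
                              * ennreal (t_mix (\<Omega> n) (X n) (\<pi> n) \<epsilon>)) \<longlonglongrightarrow> \<infinity>) \<longrightarrow>
          (\<forall>\<epsilon>\<in>{0<..<1}. (\<lambda>n. local_poincare_const (\<Omega> n) (X n) (\<pi> n) (P n) (\<A> n)
                              * ennreal (t_mix (\<Omega> n) (X n) (\<pi> n) \<epsilon>)) \<longlonglongrightarrow> \<infinity>) \<and>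
          (\<forall>\<epsilon>\<in>{0<..<1}. (\<lambda>n. t_mix (\<Omega> n) (X n) (\<pi> n) (1 - \<epsilon>)
                              / t_mix (\<Omega> n) (X n) (\<pi> n) \<epsilon>) \<longlonglongrightarrow> 1))"
proof (intro conjI allI impI)
  fix \<Omega> :: "'w measure" and X :: "real \<Rightarrow> 'w \<Rightarrow> 'a" and \<pi> :: "'a measure"
    and P :: "real \<Rightarrow> 'a \<Rightarrow> 'a measure" and \<A> :: "('a \<Rightarrow> real) set" and \<epsilon> :: real
  assume "markov_mixing_process \<Omega> X \<pi> P \<A>" and \<epsilon>: "0 < \<epsilon>" "\<epsilon> \<le> 1 / 2"
  then interpret markov_mixing_process \<Omega> X \<pi> P \<A> by simp
  show "ennreal (w_mix \<Omega> X \<pi> \<epsilon>) \<le> 3 / (2 * local_poincare_const \<Omega> X \<pi> P \<A>) * ennreal (ln (1 / \<epsilon>))"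
    unfolding w_mix_def
    by (rule ennreal_le_divide_of_mult_le) (use \<epsilon> t_mix_le in auto)
next
  fix \<Omega> :: "nat \<Rightarrow> 'w measure" and X :: "nat \<Rightarrow> real \<Rightarrow> 'w \<Rightarrow> 'a" and \<pi> :: "nat \<Rightarrow> 'a measure"
    and P :: "nat \<Rightarrow> real \<Rightarrow> 'a \<Rightarrow> 'a measure" and \<A> :: "nat \<Rightarrow> ('a \<Rightarrow> real) set"
  assume M: "\<forall>n. markov_mixing_process (\<Omega> n) (X n) (\<pi> n) (P n) (\<A> n)"
  then have M: "markov_mixing_process (\<Omega> n) (X n) (\<pi> n) (P n) (\<A> n)" for n by blast
  let ?\<gamma> = "\<lambda>n. local_poincare_const (\<Omega> n) (X n) (\<pi> n) (P n) (\<A> n)"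
  let ?T = "\<lambda>n. t_mix (\<Omega> n) (X n) (\<pi> n)"
  assume "\<exists>\<epsilon>\<in>{0<..<1}. (\<lambda>n. ?\<gamma> n * ennreal (?T n \<epsilon>)) \<longlonglongrightarrow> \<infinity>"
  then obtain \<epsilon>0 where \<epsilon>0: "\<epsilon>0 \<in> {0<..<1}" "(\<lambda>n. ?\<gamma> n * ennreal (?T n \<epsilon>0)) \<longlonglongrightarrow> \<infinity>" by blast
  have C: "0 \<le> 3 / 2 * ln (1 / \<epsilon>)" if "0 < \<epsilon>" "\<epsilon> < 1" for \<epsilon> :: real
    using that by simp
  note cutoff = cutoff_of_window_bound[where T="?T" and a="?\<gamma>" and C="\<lambda>\<epsilon>. 3 / 2 * ln (1 / \<epsilon>)",
      OF markov_mixing_process.t_mix_nonneg[OF M] markov_mixing_process.t_mix_antimono[OF M]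
        markov_mixing_process.t_mix_le[OF M] C \<epsilon>0]
  show "\<forall>\<epsilon>\<in>{0<..<1}. (\<lambda>n. ?\<gamma> n * ennreal (?T n \<epsilon>)) \<longlonglongrightarrow> \<infinity>" by (rule cutoff(1))
  show "\<forall>\<epsilon>\<in>{0<..<1}. (\<lambda>n. ?T n (1 - \<epsilon>) / ?T n \<epsilon>) \<longlonglongrightarrow> 1" by (rule cutoff(2))
qed

end
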